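(* Let $\mathfrak{F}\subseteq\mathfrak{F}_{\mathrm{all}}$ satisfy $\mathfrak{F}\supseteq\mathfrak{F}_{\mathrm{AR}(2)}^{ext}$. Let $T$ be a nonsphericity-corrected F-type test statistic based on $\check\beta$ and $\check\Omega$, where $(\check\beta,\check\Omega,N)$ satisfies the estimator conditions. Furthermore, assume that for every $v\in\mathbb{R}^q$ with $v\ne0$ we have $\lambda_{\mathbb{R}^n}(\{y\in\mathbb{R}^n\setminus N^*:v'\check\Omega^{-1}(y)v=0\})=0$. Suppose there exists a $\gamma\in[0,\pi]$ such that $\mathrm{span}(E_{n,\rho(\gamma)}(\gamma))\subseteq\mathrm{span}(X)$, where $\rho(\gamma)=\rho(\gamma,\mathfrak{M}_0^{lin})$. Then for every critical value $C$, $-\infty<C<\infty$, for every $\mu_0\in\mathfrak{M}_0$, and for every $\sigma^2\in(0,\infty)$ it holds that $$P_{0,I_n}(\check\Omega\text{ is nonnegative definite})\le K(\gamma)\le\sup_{f\in\mathfrak{F}}P_{\mu_0,\sigma^2\Sigma(f)}(T\ge C),$$ where $$K(\gamma)=\int\Pr\left(\bar\xi_\gamma(x)\ge0\right)dP_{0,I_{\kappa(\gamma,1)}}(x),$$ and where, for $\mathbf{G}$ a standard normal random $n$-vector, the random variable $\bar\xi_\gamma(x)$ is given by $$\bar\xi_\gamma(x)=\left(R\hat\beta_X(\bar E_{n,\rho(\gamma)}(\gamma)x)\right)'\check\Omega^{-1}(\mathbf{G})\,R\hat\beta_X(\bar E_{n,\rho(\gamma)}(\gamma)x)$$ on the event $\{\mathbf{G}\in\mathbb{R}^n\setminus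 N^*\}$ and by $\bar\xi_\gamma(x)=0$ otherwise. Here $\bar E_{n,\rho(\gamma)}(\gamma)=E_{n,\rho(\gamma)}(\gamma)$ if $\gamma\in(0,\pi)$, and $\bar E_{n,\rho(\gamma)}(\gamma)$ is the first column of $E_{n,\rho(\gamma)}(\gamma)$ if $\gamma\in\{0,\pi\}$.
   Context: Model: $n,k,q$ are positive integers with $1\le k<n$; $X\in\mathbb{R}^{n\times k}$ is a fixed matrix of rank $k$; $R\in\mathbb{R}^{q\times k}$ has rank $q\ge 1$; $r\in\mathbb{R}^q$. (One tests $R\beta=r$ in $\mathbf{Y}=X\beta+\mathbf{U}$, $\mathbf{U}\sim N(0,\sigma^2\Sigma(f))$, $0<\sigma^2<\infty$, $f\in\mathfrak{F}$.) Here $\mathrm{span}(\cdot)$ is column space, $'$ is transpose, $\mathfrak{M}=\mathrm{span}(X)$, $\mathfrak{M}_0=\{X\beta:R\beta=r\}$, $\mathfrak{M}_0^{lin}=\{X\beta:R\beta=0\}$, $\hat\beta_X(y)=(X'X)^{-1}X'y$. $P_{\mu,A}$ is the Gaussian measure with mean $\mu$ and covariance $A$ (on $\mathbb{R}^n$, or on $\mathbb{R}^{\kappa(\gamma,1)}$ for $P_{0,I_{\kappa(\gamma,1)}}$); $P(T\ge C)$ means $P(\{y:T(y)\ge C\})$; $P_{0,I_n}(\check\Omega$ is nonnegative definite$)$ is the $P_{0,I_n}$-probability of the set of $y\in\mathbb{R}^n\setminus N$ with $\check\Omega(y)$ nonnegative definite. $\lambda_{\mathbb{R}^n}$ is Lebesgue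 measure; $\Pr$ is a generic probability. Spectral densities: $\mathfrak{F}_{\mathrm{all}}$ is the set of all normalized spectral densities of real weakly stationary processes (nonnegative, even, integrable $f$ on $[-\pi,\pi]$ with $\int_{-\pi}^{\pi}f=1$); $\mathfrak{F}_{\mathrm{AR}(2)}$ is the subset of those corresponding to stationary autoregressive processes of order at most two; $\mathfrak{F}_{\mathrm{AR}(2)}^{ext}$ is the set of all $c_1f+(2\pi)^{-1}c_2$ with $f\in\mathfrak{F}_{\mathrm{AR}(2)}$, $c_1,c_2\ge0$, $c_1+c_2=1$; $\Sigma(f)=\left[\int_{-\pi}^{\pi}e^{-\iota(j-l)\omega}f(\omega)d\omega\right]_{j,l=1}^n$, $\iota$ the imaginary unit. For $\omega\in[0,\pi]$ and integer $s\ge0$, $E_{n,s}(\omega)$ is the $n\times2$ matrix with $j$-th row $(j^s\cos(j\omega),j^s\sin(j\omega))$. For a linear subspace $\mathcal{L}$ of $\mathbb{R}^n$ with $\dim\mathcal{L}<n$, $\rho(\omega,\mathcal{L})=\min\{s\in\mathbb{N}\cup\{0\}:\mathrm{span}(E_{n,s}(\omega))\nsubseteq\mathcal{L}\}$ (well-defined). $\kappa(\gamma,1)=2$ for $\gamma\in(0,\pi)$ and $\kappa(\gamma,1)=1$ for $\gamma\in\{0,\pi\}$. Estimator conditions on $(\check\beta,\check\Omega,N)$: (i) $\check\beta:\mathbb{R}^n\setminus N\to\mathbb{R}^k$ and $\check\Omega:\mathbb{R}^n\setminus N\to\mathbb{R}^{q\times q}$ are well-defined and continuous on $\mathbb{R}^n\setminus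 N$, where $N$ is a closed $\lambda_{\mathbb{R}^n}$-null set, and $\check\Omega(y)$ is symmetric for every $y\in\mathbb{R}^n\setminus N$; (ii) $y\in\mathbb{R}^n\setminus N$ implies $\delta y+X\eta\in\mathbb{R}^n\setminus N$ for all $\delta\ne0$, $\eta\in\mathbb{R}^k$; (iii) $\check\beta(\delta y+X\eta)=\delta\check\beta(y)+\eta$ and $\check\Omega(\delta y+X\eta)=\delta^2\check\Omega(y)$ for all $y\in\mathbb{R}^n\setminus N$, $\delta\neq0$, $\eta\in\mathbb{R}^k$; (iv) $\check\Omega$ is $\lambda_{\mathbb{R}^n}$-almost everywhere nonsingular on $\mathbb{R}^n\setminus N$. Nonsphericity-corrected F-type test statistic: with $N^*=N\cup\{y\in\mathbb{R}^n\setminus N:\det\check\Omega(y)=0\}$, $T(y)=(R\check\beta(y)-r)'\check\Omega^{-1}(y)(R\check\beta(y)-r)$ for $y\in\mathbb{R}^n\setminus N^*$ and $T(y)=0$ for $y\in N^*$. *)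

theory Defs
  imports "HOL-Probability.Probability"
begin

definition std_gaussian :: "(real ^ 'm) measure" where
  "std_gaussian = density lborel (\<lambda>z. ennreal (\<Prod>i\<in>UNIV. std_normal_density (z $ i)))"

text \<open>
  The law of \<open>\<mu> + B Z\<close> for a standard normal vector \<open>Z\<close> and a matrix factor \<open>B\<close> with
  \<open>B B' = A\<close>.  Every nonnegative definite symmetric \<open>A\<close> has such a factor, and the law does not
  depend on which one is chosen.
\<close>

definition gaussian :: "real ^ 'm \<Rightarrow> real ^ 'm ^ 'm \<Rightarrow> (real ^ 'm) measure" where
  "gaussian \<mu> A =
     distr std_gaussian borel (\<lambda>z. \<mu> + (SOME B :: real ^ 'm ^ 'm. B ** transpose B = A) *v z)"

text \<open>
  A function on \<open>[-\<pi>, \<pi>]\<close> is represented by an element of \<^term>\<open>extensional {-pi..pi}\<close>.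
\<close>

definition F_all :: "(real \<Rightarrow> real) set" where
  "F_all = {f \<in> extensional {-pi..pi}.
      (\<forall>\<omega>\<in>{-pi..pi}. 0 \<le> f \<omega>) \<and>
      (\<forall>\<omega>\<in>{-pi..pi}. f (- \<omega>) = f \<omega>) \<and>
      f absolutely_integrable_on {-pi..pi} \<and>
      integral {-pi..pi} f = 1}"

text \<open>
  The stationary autoregression \<open>X\<^sub>t = a\<^sub>1 X\<^sub>t\<^sub>-\<^sub>1 + a\<^sub>2 X\<^sub>t\<^sub>-\<^sub>2 + \<epsilon>\<^sub>t\<close> with innovation variance \<open>v\<close>
  has spectral density \<open>v / (2 \<pi>) |1 - a\<^sub>1 e\<^sup>-\<^sup>i\<^sup>\<omega> - a\<^sub>2 e\<^sup>-\<^sup>2\<^sup>i\<^sup>\<omega>|\<^sup>-\<^sup>2\<close>; stationarity means that the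
  autoregressive polynomial has no zero in the closed unit disc.  Orders zero and one are the
  cases of vanishing coefficients.
\<close>

definition F_AR2 :: "(real \<Rightarrow> real) set" where
  "F_AR2 = {f \<in> F_all. \<exists>a1 a2 v :: real. 0 < v \<and>
      (\<forall>z :: complex. norm z \<le> 1 \<longrightarrow> 1 - of_real a1 * z - of_real a2 * z ^ 2 \<noteq> 0) \<and>
      (\<forall>\<omega>\<in>{-pi..pi}. f \<omega> = v / (2 * pi) /
         (norm (1 - of_real a1 * exp (- (\<i> * of_real \<omega>))
                  - of_real a2 * exp (- (2 * \<i> * of_real \<omega>)))) ^ 2)}"

definition F_AR2_ext :: "(real \<Rightarrow> real) set" where
  "F_AR2_ext = {(\<lambda>\<omega>\<in>{-pi..pi}. c1 * f \<omega> + c2 / (2 * pi)) | c1 c2 f.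
      f \<in> F_AR2 \<and> 0 \<le> c1 \<and> 0 \<le> c2 \<and> c1 + c2 = 1}"

text \<open>
  The coordinates of \<open>real ^ 'n\<close> are enumerated as \<open>1, \<dots>, n\<close> along the linear order of the index
  type.
\<close>

definition pos :: "'n::{finite,linorder} \<Rightarrow> nat" where
  "pos j = card {i. i \<le> j}"

text \<open>
  The integral is real because \<open>f\<close> is even, so that taking the real part only changes the type.
\<close>

definition Sigma_mat :: "(real \<Rightarrow> real) \<Rightarrow> real ^ ('n::{finite,linorder}) ^ ('n::{finite,linorder})" where
  "Sigma_mat f = (\<chi> j l. Re (integral {-pi..pi}
      (\<lambda>\<omega>. exp (- (\<i> * of_real ((real (pos j) - real (pos l)) * \<omega>))) * of_real (f \<omega>))))"

definition M0 :: "real ^ 'k ^ 'n \<Rightarrow> real ^ 'k ^ 'q \<Rightarrow> real ^ 'q \<Rightarrow> (real ^ 'n) set" where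
  "M0 X R r = {X *v \<beta> | \<beta>. R *v \<beta> = r}"

abbreviation M0_lin :: "real ^ 'k ^ 'n \<Rightarrow> real ^ 'k ^ 'q \<Rightarrow> (real ^ 'n) set" where
  "M0_lin X R \<equiv> M0 X R 0"

definition beta_hat :: "real ^ 'k ^ 'n \<Rightarrow> real ^ 'n \<Rightarrow> real ^ 'k" where
  "beta_hat X y = matrix_inv (transpose X ** X) *v (transpose X *v y)"

definition E_mat :: "nat \<Rightarrow> real \<Rightarrow> real ^ 2 ^ ('n::{finite,linorder})" where
  "E_mat s \<omega> = (\<chi> j. vector [real (pos j) ^ s * cos (real (pos j) * \<omega>),
                             real (pos j) ^ s * sin (real (pos j) * \<omega>)])"

definition first_column :: "real ^ 2 ^ 'n \<Rightarrow> real ^ 1 ^ 'n" where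
  "first_column E = (\<chi> j c. E $ j $ 1)"

definition rho :: "real \<Rightarrow> (real ^ ('n::{finite,linorder})) set \<Rightarrow> nat" where
  "rho \<omega> L = (LEAST s. \<not> span (columns (E_mat s \<omega> :: real ^ 2 ^ ('n::{finite,linorder}))) \<subseteq> L)"

definition estimator_conditions ::
  "real ^ 'k ^ 'n \<Rightarrow> (real ^ 'n \<Rightarrow> real ^ 'k) \<Rightarrow> (real ^ 'n \<Rightarrow> real ^ 'q ^ 'q) \<Rightarrow>
   (real ^ 'n) set \<Rightarrow> bool" where
  "estimator_conditions X \<beta>c \<Omega>c N \<longleftrightarrow>
     closed N \<and> N \<in> null_sets lebesgue \<and>
     continuous_on (- N) \<beta>c \<and> continuous_on (- N) \<Omega>c \<and>
     (\<forall>y. y \<notin> N \<longrightarrow> transpose (\<Omega>c y) = \<Omega>c y) \<and>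
     (\<forall>y \<delta> \<eta>. y \<notin> N \<longrightarrow> \<delta> \<noteq> 0 \<longrightarrow> \<delta> *\<^sub>R y + X *v \<eta> \<notin> N) \<and>
     (\<forall>y \<delta> \<eta>. y \<notin> N \<longrightarrow> \<delta> \<noteq> 0 \<longrightarrow>
        \<beta>c (\<delta> *\<^sub>R y + X *v \<eta>) = \<delta> *\<^sub>R \<beta>c y + \<eta> \<and>
        \<Omega>c (\<delta> *\<^sub>R y + X *v \<eta>) = \<delta>\<^sup>2 *\<^sub>R \<Omega>c y) \<and>
     (AE y in lebesgue. y \<notin> N \<longrightarrow> det (\<Omega>c y) \<noteq> 0)"

definition N_star :: "(real ^ 'n \<Rightarrow> real ^ 'q ^ 'q) \<Rightarrow> (real ^ 'n) set \<Rightarrow> (real ^ 'n) set" where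
  "N_star \<Omega>c N = N \<union> {y. y \<notin> N \<and> det (\<Omega>c y) = 0}"

definition T_stat ::
  "real ^ 'k ^ 'q \<Rightarrow> real ^ 'q \<Rightarrow> (real ^ 'n \<Rightarrow> real ^ 'k) \<Rightarrow> (real ^ 'n \<Rightarrow> real ^ 'q ^ 'q) \<Rightarrow>
   (real ^ 'n) set \<Rightarrow> real ^ 'n \<Rightarrow> real" where
  "T_stat R r \<beta>c \<Omega>c N y =
     (if y \<notin> N_star \<Omega>c N
      then (R *v \<beta>c y - r) \<bullet> (matrix_inv (\<Omega>c y) *v (R *v \<beta>c y - r))
      else 0)"

definition nonneg_definite :: "real ^ 'q ^ 'q \<Rightarrow> bool" where
  "nonneg_definite A \<longleftrightarrow> transpose A = A \<and> (\<forall>v. 0 \<le> v \<bullet> (A *v v))"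

text \<open>
  In the next two definitions \<open>E\<close> is \<open>n \<times> 2\<close> or \<open>n \<times> 1\<close>, depending on the frequency.  The
  argument \<open>g\<close> of \<open>xi_bar\<close> is the realization of the standard normal vector \<open>G\<close>.
\<close>

definition xi_bar ::
  "real ^ 'k ^ 'n \<Rightarrow> real ^ 'k ^ 'q \<Rightarrow> (real ^ 'n \<Rightarrow> real ^ 'q ^ 'q) \<Rightarrow> (real ^ 'n) set \<Rightarrow>
   real ^ 'm ^ 'n \<Rightarrow> real ^ 'm \<Rightarrow> real ^ 'n \<Rightarrow> real" where
  "xi_bar X R \<Omega>c N E x g =
     (if g \<notin> N_star \<Omega>c N
      then (R *v beta_hat X (E *v x)) \<bullet> (matrix_inv (\<Omega>c g) *v (R *v beta_hat X (E *v x)))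
      else 0)"

definition K_int ::
  "'w measure \<Rightarrow> ('w \<Rightarrow> real ^ 'n) \<Rightarrow> real ^ 'k ^ 'n \<Rightarrow> real ^ 'k ^ 'q \<Rightarrow>
   (real ^ 'n \<Rightarrow> real ^ 'q ^ 'q) \<Rightarrow> (real ^ 'n) set \<Rightarrow> real ^ 'm ^ 'n \<Rightarrow> real" where
  "K_int M G X R \<Omega>c N E =
     (\<integral>x. measure M {w \<in> space M. 0 \<le> xi_bar X R \<Omega>c N E x (G w)} \<partial>gaussian 0 (mat 1))"

definition K_bound ::
  "'w measure \<Rightarrow> ('w \<Rightarrow> real ^ ('n::{finite,linorder})) \<Rightarrow> real ^ 'k ^ ('n::{finite,linorder}) \<Rightarrow> real ^ 'k ^ 'q \<Rightarrow>
   (real ^ ('n::{finite,linorder}) \<Rightarrow> real ^ 'q ^ 'q) \<Rightarrow> (real ^ ('n::{finite,linorder})) set \<Rightarrow> real \<Rightarrow> real" where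
  "K_bound M G X R \<Omega>c N \<gamma> =
     (let E = E_mat (rho \<gamma> (M0_lin X R)) \<gamma>
      in if 0 < \<gamma> \<and> \<gamma> < pi then K_int M G X R \<Omega>c N E
         else K_int M G X R \<Omega>c N (first_column E))"

end

theory Submission
  imports Defs
begin

text \<open>
  Up to the location of the null hypothesis, the statistic is invariant under scaling and under
  shifts by the linear space \<open>L\<close> parallel to it.  When the roots of an autoregression of order two
  tend to \<open>e\<^sup>\<plusminus>\<^sup>i\<^sup>\<theta>\<close>, its normalized covariance matrix tends to \<open>E\<^sub>0(\<theta>) E\<^sub>0(\<theta>)'\<close>.  Mixing in white
  noise, and using continuity of the Gaussian law in a positive definite covariance, one sees that
  the supremum is at least the rejection probability at \<open>E\<^sub>0(\<theta>) x + s z\<close> for all \<open>\<theta> \<in> (0, \<pi>)\<close> and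
  \<open>s \<noteq> 0\<close>, where \<open>x\<close> and \<open>z\<close> are independent standard normal vectors.  Now let \<open>\<theta>\<close> tend to \<open>\<gamma>\<close> with
  \<open>s = \<epsilon> (\<theta> - \<gamma>)\<^sup>\<rho> / \<rho>!\<close>: the Taylor terms of order below \<open>\<rho>\<close> lie in \<open>L\<close>, so that
  \<open>E\<^sub>\<rho>(\<gamma>) x + \<epsilon> z\<close> remains, up to a rotation of \<open>x\<close>.  As \<open>E\<^sub>\<rho>(\<gamma>) x\<close> lies in the column space of
  \<open>X\<close>, equivariance turns the statistic at this point into \<open>\<epsilon>\<^sup>-\<^sup>2\<close> times a quantity that tends to
  \<open>\<xi>\<close>, and letting \<open>\<epsilon>\<close> tend to \<open>0\<close> yields the lower bound \<open>P(\<xi> > 0)\<close>.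
\<close>

subsection \<open>Gaussian measures on Cartesian spaces\<close>

text \<open>For n > 2 the matrix \<open>E_mat 0 \<theta> ** transpose (E_mat 0 \<theta>)\<close> is
  singular. Without white noise the limit law would live on a plane, and the probability of the
  rejection region, a Borel set whose boundary is not controlled, need not converge. With noise the
  limit has a density, and convergence holds on every Borel set.

  Setting \<theta> = \<gamma> at once would not do: if \<rho> > 0, then
  \<open>E_mat 0 \<gamma>\<close> maps into the space that the statistic ignores, and only the noise
  is left. Hence \<theta> approaches \<gamma> while the noise shrinks at exactly the order of the
  first Taylor term that the statistic can see. Approaching from inside (0, \<pi>) also covers
  \<gamma> = 0 and \<gamma> = \<pi>.

  The three limits are taken one after the other. The last two rest on Fatou's lemma, which bounds
  only the probability of a strict inequality, so that they end at \<xi> > 0 where K asks for \<xi>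
  \<ge> 0. The hypothesis on the zeros of the quadratic form closes this gap for nonzero vectors,
  and the choice of \<rho> makes the vector in question nonzero almost surely.\<close>

definition gauss_kernel :: "real ^ 'n ^ 'n \<Rightarrow> real ^ 'n \<Rightarrow> real" where
  "gauss_kernel A u = exp (- (u \<bullet> (matrix_inv A *v u)) / 2)"

definition pos_definite :: "real ^ 'n ^ 'n \<Rightarrow> bool" where
  "pos_definite A \<longleftrightarrow> transpose A = A \<and> (\<forall>v. v \<noteq> 0 \<longrightarrow> 0 < v \<bullet> (A *v v))"

lemma std_gaussian_alt:
  "(std_gaussian :: (real ^ 'm) measure) =
     density lborel (\<lambda>z. ennreal ((1 / sqrt (2 * pi)) ^ CARD('m) * exp (- (z \<bullet> z) / 2)))"
proof -
  have "(\<Prod>i\<in>UNIV. std_normal_density (z $ i)) =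
      (1 / sqrt (2 * pi)) ^ CARD('m) * exp (- (z \<bullet> z) / 2)" for z :: "real ^ 'm"
    by (simp add: normal_density_def prod.distrib power_one_over exp_sum[symmetric] prod_dividef
        inner_vec_def power2_eq_square sum_negf sum_divide_distrib)
  then show ?thesis by (simp add: std_gaussian_def)
qed

lemma prob_space_std_gaussian: "prob_space (std_gaussian :: (real ^ 'm) measure)"
proof
  have Basis: "(Basis :: (real ^ 'm) set) = range (\<lambda>i. axis i 1)"
    by (auto simp: Basis_vec_def)
  have inj: "inj (\<lambda>i :: 'm. axis i (1 :: real))"
    by (simp add: inj_on_def axis_eq_axis)
  have "emeasure (std_gaussian :: (real ^ 'm) measure) (space std_gaussian) =
      (\<integral>\<^sup>+z. (\<Prod>b\<in>(Basis :: (real ^ 'm) set). ennreal (std_normal_density (z \<bullet> b))) \<partial>lborel)"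
    by (simp add: std_gaussian_def emeasure_density Basis prod.reindex[OF inj] prod_ennreal
        cart_eq_inner_axis o_def)
  also have "\<dots> = (\<Prod>b\<in>(Basis :: (real ^ 'm) set). \<integral>\<^sup>+x. ennreal (std_normal_density x) \<partial>lborel)"
    by (subst nn_integral_lborel_prod) auto
  also have "(\<integral>\<^sup>+x. ennreal (std_normal_density x) \<partial>lborel) = 1"
    using prob_space.emeasure_space_1[OF prob_space_normal_density[of 1 0]]
    by (simp add: emeasure_density)
  finally show "emeasure (std_gaussian :: (real ^ 'm) measure) (space std_gaussian) = 1"
    by simp
qed

lemma sets_std_gaussian [measurable_cong, simp]: "sets std_gaussian = sets borel"
  by (simp add: std_gaussian_def)

lemma space_std_gaussian [simp]: "space std_gaussian = UNIV"
  by (simp add: std_gaussian_def)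

lemma sets_gaussian [measurable_cong, simp]: "sets (gaussian \<mu> A) = sets borel"
  by (simp add: gaussian_def)

lemma space_gaussian [simp]: "space (gaussian \<mu> A) = UNIV"
  by (simp add: gaussian_def)

lemma borel_measurable_matrix_vector_mult [measurable]:
  fixes B :: "real ^ 'm ^ 'n"
  shows "(\<lambda>z. B *v z) \<in> borel_measurable borel"
  by (intro borel_measurable_continuous_onI linear_continuous_on matrix_vector_mul_bounded_linear)

lemma prob_space_gaussian: "prob_space (gaussian \<mu> A)"
  unfolding gaussian_def
  by (rule prob_space.prob_space_distr[OF prob_space_std_gaussian]) measurable

lemma gaussian_shift:
  assumes "S \<in> sets borel"
  shows "emeasure (gaussian \<mu> A) S = emeasure (gaussian 0 A) ((\<lambda>u. \<mu> + u) -` S)"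
proof -
  have "(\<lambda>u. \<mu> + u) -` S \<in> sets borel"
    using measurable_sets[of "\<lambda>u. \<mu> + u" borel borel S] assms by simp
  then show ?thesis
    using assms unfolding gaussian_def
    by (subst (1 2) emeasure_distr) (auto simp: vimage_def)
qed

text \<open>Uniqueness of Haar measure: integrate \<open>1\<^sub>S(x) g(x + y)\<close> with \<open>\<integral> g = 1\<close> in both orders.\<close>
lemma distr_lborel_linear:
  fixes f :: "'a :: euclidean_space \<Rightarrow> 'a"
  assumes "linear f" and "surj f"
  obtains c :: ennreal where "distr lborel borel f = density lborel (\<lambda>_. c)"
proof -
  have [measurable]: "f \<in> borel_measurable borel"
    using assms(1) by (intro borel_measurable_continuous_onI linear_continuous_on linear_conv_bounded_linear[THEN iffD1])
  define g :: "'a \<Rightarrow> ennreal" where "g = indicator (cbox 0 One)"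
  have [measurable]: "g \<in> borel_measurable borel" by (simp add: g_def)
  have g1: "(\<integral>\<^sup>+x. g x \<partial>lborel) = 1" by (simp add: g_def emeasure_lborel_cbox_eq)
  have trans: "(\<integral>\<^sup>+x. h (t + x) \<partial>lborel) = (\<integral>\<^sup>+x. h x \<partial>lborel)"
    if [measurable]: "h \<in> borel_measurable borel" for h :: "'a \<Rightarrow> ennreal" and t
  proof -
    have "(\<integral>\<^sup>+x. h x \<partial>lborel) = (\<integral>\<^sup>+x. h x \<partial>distr lborel borel ((+) t))"
      by (simp add: lborel_distr_plus)
    then show ?thesis by (simp add: nn_integral_distr)
  qed
  \<comment> \<open>Exchanging the integrals leaves y with a minus sign inside the indicator;
    reflection invariance removes it.\<close>
  have refl: "(\<integral>\<^sup>+x. h (- x) \<partial>lborel) = (\<integral>\<^sup>+x. h x \<partial>lborel)"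
    if [measurable]: "h \<in> borel_measurable borel" for h :: "'a \<Rightarrow> ennreal"
  proof -
    have "(\<integral>\<^sup>+x. h x \<partial>lborel) = (\<integral>\<^sup>+x. h x \<partial>density (distr lborel borel (\<lambda>x. 0 + (-1) *\<^sub>R x)) (\<lambda>x. ennreal (\<bar>-1\<bar> ^ DIM('a))))"
      by (subst lborel_affine[of "-1" "0 :: 'a"]) auto
    then show ?thesis by (simp add: nn_integral_distr nn_integral_density)
  qed
  \<comment> \<open>The constant is not identified with the inverse of |det f|: total mass one will
    fix it wherever it matters.\<close>
  define c where "c = (\<integral>\<^sup>+x. g (f x) \<partial>lborel)"
  have eq: "emeasure lborel (f -` S) = c * emeasure lborel S" if [measurable]: "S \<in> sets borel" for S
  proof -
    have [measurable]: "f -` S \<in> sets borel" using measurable_sets[of f borel borel S] by simp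
    have "emeasure lborel (f -` S) = (\<integral>\<^sup>+x. indicator S (f x) * (\<integral>\<^sup>+y. g (f x + y) \<partial>lborel) \<partial>lborel)"
      by (simp add: trans g1 indicator_vimage[symmetric] vimage_def flip: nn_integral_indicator)
    also have "\<dots> = (\<integral>\<^sup>+x. \<integral>\<^sup>+y. indicator S (f x) * g (f x + y) \<partial>lborel \<partial>lborel)"
      by (simp add: nn_integral_cmult)
    also have "\<dots> = (\<integral>\<^sup>+y. \<integral>\<^sup>+x. indicator S (f x) * g (f x + y) \<partial>lborel \<partial>lborel)"
      by (rule lborel_pair.Fubini') measurable
    also have "\<dots> = (\<integral>\<^sup>+y. \<integral>\<^sup>+x. indicator S (f x - y) * g (f x) \<partial>lborel \<partial>lborel)"
    proof (rule nn_integral_cong)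
      fix y
      \<comment> \<open>Surjectivity turns the shift by y into a shift of the integration variable,
        which moves y from \<open>g\<close> into the indicator.\<close>
      obtain x0 where x0: "f x0 = y" using \<open>surj f\<close> by (metis surjD)
      have "(\<integral>\<^sup>+x. indicator S (f x) * g (f x + y) \<partial>lborel) =
          (\<integral>\<^sup>+x. indicator S (f (- x0 + x)) * g (f (- x0 + x) + y) \<partial>lborel)"
        by (rule trans[symmetric]) measurable
      then show "(\<integral>\<^sup>+x. indicator S (f x) * g (f x + y) \<partial>lborel) =
          (\<integral>\<^sup>+x. indicator S (f x - y) * g (f x) \<partial>lborel)"
        by (simp add: linear_diff[OF \<open>linear f\<close>] x0 flip: diff_conv_add_uminus uminus_add_conv_diff)
           (simp add: linear_diff[OF \<open>linear f\<close>] linear_add[OF \<open>linear f\<close>] linear_neg[OF \<open>linear f\<close>] x0)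
    qed
    also have "\<dots> = (\<integral>\<^sup>+x. \<integral>\<^sup>+y. indicator S (f x - y) * g (f x) \<partial>lborel \<partial>lborel)"
      by (rule lborel_pair.Fubini') measurable
    also have "\<dots> = (\<integral>\<^sup>+x. g (f x) * emeasure lborel S \<partial>lborel)"
    proof (rule nn_integral_cong)
      fix x
      have "(\<integral>\<^sup>+y. indicator S (f x - y) * g (f x) \<partial>lborel) =
          g (f x) * (\<integral>\<^sup>+y. indicator S (f x + - y) \<partial>lborel)"
        by (subst nn_integral_cmult[symmetric]) (auto simp: mult.commute)
      also have "(\<integral>\<^sup>+y. indicator S (f x + - y) \<partial>lborel) = (\<integral>\<^sup>+y. indicator S (f x + y) \<partial>lborel)"
        using refl[of "\<lambda>y. indicator S (f x + y)"] by simp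
      also have "\<dots> = emeasure lborel S"
        using trans[of "indicator S" "f x"] by simp
      finally show "(\<integral>\<^sup>+y. indicator S (f x - y) * g (f x) \<partial>lborel) = g (f x) * emeasure lborel S" .
    qed
    also have "\<dots> = c * emeasure lborel S"
      by (simp add: nn_integral_multc c_def)
    finally show ?thesis .
  qed
  have "distr lborel borel f = density lborel (\<lambda>_. c)"
    by (rule measure_eqI) (auto simp: emeasure_distr emeasure_density_const eq)
  with that show ?thesis .
qed

text \<open>Both \<open>c\<close> and \<open>d\<close> are inverse to the same total mass. A
  probability law is therefore determined by its kernel, and no determinant has to be
  computed.\<close>

lemma density_proportional_eq:
  fixes k :: "'a \<Rightarrow> ennreal"
  assumes "prob_space (density M (\<lambda>u. c * k u))" and "prob_space (density M (\<lambda>u. d * k u))"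
    and [measurable]: "k \<in> borel_measurable M"
  shows "density M (\<lambda>u. c * k u) = density M (\<lambda>u. d * k u)"
proof -
  have "c * integral\<^sup>N M k = 1" "d * integral\<^sup>N M k = 1"
    using assms(1,2)[THEN prob_space.emeasure_space_1]
    by (simp_all add: emeasure_density nn_integral_cmult mult.commute)
  \<comment> \<open>No division in \<open>ennreal\<close> is needed: if I is the common integral,
    then c = c (d I) = d (c I) = d.\<close>
  then have "c = d"
    by (metis (no_types, lifting) mult.assoc mult.commute mult_1)
  then show ?thesis by simp
qed

section \<open>Inverses and factors of positive definite matrices\<close>

lemma invertible_matrix_inv:
  fixes A :: "real ^ 'n ^ 'n"
  assumes "invertible A"
  shows "A ** matrix_inv A = mat 1" "matrix_inv A ** A = mat 1"
proof -
  have "A ** matrix_inv A = mat 1 \<and> matrix_inv A ** A = mat 1"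
    unfolding matrix_inv_def using assms unfolding invertible_def by (rule someI_ex)
  then show "A ** matrix_inv A = mat 1" "matrix_inv A ** A = mat 1" by auto
qed

lemma matrix_inv_mult_vector:
  fixes A :: "real ^ 'n ^ 'n"
  assumes "invertible A"
  shows "A *v (matrix_inv A *v u) = u" "matrix_inv A *v (A *v u) = u"
  using invertible_matrix_inv[OF assms] by (simp_all add: matrix_vector_mul_assoc)

lemma pos_definite_invertible:
  fixes A :: "real ^ 'n ^ 'n"
  assumes "pos_definite A"
  shows "invertible A"
proof -
  have "A *v x \<noteq> 0" if "x \<noteq> 0" for x
    using assms that unfolding pos_definite_def by force
  then show ?thesis
    by (metis matrix_left_invertible_ker invertible_left_inverse)
qed

lemma inner_matrix_vector_transpose:
  fixes A :: "real ^ 'n ^ 'm"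
  shows "x \<bullet> (A *v y) = (transpose A *v x) \<bullet> y"
  by (simp add: dot_lmul_matrix)

lemma matrix_scaleR_vector: 
  fixes A :: "real ^ 'n ^ 'm"
  shows "(c *\<^sub>R A) *v x = c *\<^sub>R (A *v x)"
  by (simp add: vec_eq_iff matrix_vector_mult_def sum_distrib_left mult.assoc)

text \<open>The columns of \<open>B\<^sup>-\<^sup>T\<close> form a maximal family that is orthonormal for the inner product given by \<open>A\<close>.\<close>
lemma pos_definite_factor:
  fixes A :: "real ^ 'n ^ 'n"
  assumes "pos_definite A"
  shows "\<exists>B :: real ^ 'n ^ 'n. B ** transpose B = A"
proof -
  have sym: "x \<bullet> (A *v y) = y \<bullet> (A *v x)" for x y
    using assms unfolding pos_definite_def
    by (metis inner_matrix_vector_transpose inner_commute)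
  have posA: "0 < v \<bullet> (A *v v)" if "v \<noteq> 0" for v
    using assms that by (simp add: pos_definite_def)
  define orth :: "(real ^ 'n) set \<Rightarrow> bool" where
    "orth S \<longleftrightarrow> finite S \<and> (\<forall>x\<in>S. \<forall>y\<in>S. x \<bullet> (A *v y) = (if x = y then 1 else 0))" for S
  have expand: "(\<Sum>x\<in>S. c x *\<^sub>R x) \<bullet> (A *v y) = c y" if "orth S" "y \<in> S" for S c y
  proof -
    have "(\<Sum>x\<in>S. c x *\<^sub>R x) \<bullet> (A *v y) = (\<Sum>x\<in>S. c x * (if x = y then 1 else 0))"
      using that unfolding orth_def inner_sum_left by (intro sum.cong) auto
    also have "\<dots> = (\<Sum>x\<in>S. if x = y then c x else 0)"
      by (intro sum.cong) auto
    finally show ?thesis using that by (simp add: orth_def)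
  qed
  have indep: "independent S" if "orth S" for S
  proof -
    have "finite S" using that by (simp add: orth_def)
    then show ?thesis
      using expand[OF that] by (subst independent_explicit) (metis inner_zero_left)
  qed
  have card_le: "card S \<le> CARD('n)" if "orth S" for S
    using independent_bound[OF indep[OF that]] by simp
  obtain S where S: "orth S" and max: "\<And>S'. orth S' \<Longrightarrow> card S' \<le> card S"
  proof -
    have "orth {}" by (simp add: orth_def)
    then have "\<exists>S. orth S \<and> (\<forall>S'. orth S' \<longrightarrow> card S' \<le> card S)"
      using ex_has_greatest_nat[of orth "{}" card "CARD('n) + 1"] card_le by (auto simp: less_Suc_eq_le)
    then show ?thesis using that by blast
  qed
  have finS: "finite S" using S by (simp add: orth_def)
  have "card S = CARD('n)"
  proof (rule ccontr)
    assume "card S \<noteq> CARD('n)"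
    then have "card S < CARD('n)" using card_le[OF S] by simp
    then have "span S \<noteq> UNIV"
      using dim_le_card[of UNIV S] finS by (auto simp: dim_UNIV)
    then obtain x where x: "x \<notin> span S" by auto
    \<comment> \<open>One Gram-Schmidt step for the inner product given by A: \<open>y\<close> is
      \<open>x\<close> without its projection on the span of S. Normalized, it enlarges S and
      contradicts maximality.\<close>
    define y where "y = x - (\<Sum>s\<in>S. (x \<bullet> (A *v s)) *\<^sub>R s)"
    have "(\<Sum>s\<in>S. (x \<bullet> (A *v s)) *\<^sub>R s) \<in> span S"
      by (intro span_sum span_scale span_base)
    then have "y \<notin> span S"
      using x unfolding y_def by (metis diff_add_cancel span_add)
    then have "y \<noteq> 0" by (metis span_zero)
    define w where "w = (1 / sqrt (y \<bullet> (A *v y))) *\<^sub>R y"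
    have yS: "y \<bullet> (A *v s) = 0" if "s \<in> S" for s
      using expand[OF S that] by (simp add: y_def inner_diff_left)
    have "w \<notin> S"
    proof
      assume "w \<in> S"
      then have "w \<in> span S" by (rule span_base)
      then have "sqrt (y \<bullet> (A *v y)) *\<^sub>R w \<in> span S" by (rule span_scale)
      then show False using \<open>y \<notin> span S\<close> posA[OF \<open>y \<noteq> 0\<close>] by (simp add: w_def)
    qed
    moreover have "orth (insert w S)"
    proof -
      have "w \<bullet> (A *v w) = 1"
        using posA[OF \<open>y \<noteq> 0\<close>] by (simp add: w_def matrix_vector_mult_scaleR)
      moreover have "w \<bullet> (A *v s) = 0" if "s \<in> S" for s
        using yS[OF that] by (simp add: w_def)
      ultimately show ?thesis
        using S \<open>w \<notin> S\<close> sym unfolding orth_def by (auto split: if_splits)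
    qed
    ultimately show False using max[of "insert w S"] finS by simp
  qed
  then obtain h where h: "bij_betw h (UNIV :: 'n set) S"
    using finite_same_card_bij[of "UNIV :: 'n set" S] finS by auto
  define P :: "real ^ 'n ^ 'n" where "P = (\<chi> i j. h j $ i)"
  have "transpose P ** (A ** P) = mat 1"
  proof -
    have "(transpose P ** (A ** P)) $ i $ j = h i \<bullet> (A *v h j)" for i j
      by (simp add: P_def transpose_def matrix_matrix_mult_def matrix_vector_mult_def inner_vec_def)
    moreover have "h i \<bullet> (A *v h j) = (if i = j then 1 else 0)" for i j
      using S h unfolding orth_def by (auto simp: bij_betw_def inj_on_def)
    ultimately show ?thesis by (simp add: vec_eq_iff mat_def)
  qed
  then have 1: "(transpose P ** A) ** P = mat 1" by (simp add: matrix_mul_assoc)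
  then have 2: "P ** (transpose P ** A) = mat 1" by (simp add: matrix_left_right_inverse)
  \<comment> \<open>From P' A P = 1 it follows that B' is the inverse of P, so that B B' is the
    inverse of P P', which is A.\<close>
  define B where "B = transpose (transpose P ** A)"
  have "transpose B ** P = mat 1" using 1 by (simp add: B_def)
  then have BP: "transpose P ** B = mat 1"
    by (metis matrix_transpose_mul transpose_mat transpose_transpose)
  then have "B ** transpose P = mat 1" by (simp add: matrix_left_right_inverse)
  then have "B ** (transpose P ** A) = A"
    by (simp add: matrix_mul_assoc)
  then show ?thesis by (intro exI[of _ B]) (simp add: B_def)
qed

section \<open>Gaussian laws identified by their unnormalized densities\<close>

lemma gauss_kernel_pos: "0 < gauss_kernel A u"
  by (simp add: gauss_kernel_def)

lemma borel_measurable_gauss_kernel [measurable]: "gauss_kernel A \<in> borel_measurable borel"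
  unfolding gauss_kernel_def by measurable

text \<open>The Jacobian is absorbed in \<open>c\<close>. What remains is |B^-1 u|^2 = u' (B B')^-1
  u, so that up to \<open>c\<close> the density depends on B only through B B'.\<close>

lemma distr_std_gaussian_linear:
  fixes B :: "real ^ 'n ^ 'n"
  assumes "invertible B"
  obtains c :: ennreal where
    "distr std_gaussian borel (\<lambda>z. B *v z) =
      density lborel (\<lambda>u. c * ennreal (gauss_kernel (B ** transpose B) u))"
proof -
  define \<phi> :: "real ^ 'n \<Rightarrow> real" where
    "\<phi> z = (1 / sqrt (2 * pi)) ^ CARD('n) * exp (- (z \<bullet> z) / 2)" for z
  have [measurable]: "\<phi> \<in> borel_measurable borel" unfolding \<phi>_def by measurable
  have std: "(std_gaussian :: (real ^ 'n) measure) = density lborel (\<lambda>z. ennreal (\<phi> z))"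
    by (simp add: std_gaussian_alt \<phi>_def)
  let ?A = "B ** transpose B" and ?C = "matrix_inv B"
  have invt: "invertible (transpose B)" using assms by (metis invertible_def matrix_transpose_mul transpose_mat)
  have invA: "invertible ?A" using assms invt by (rule invertible_mult)
  have kern: "u \<bullet> (matrix_inv ?A *v u) = (?C *v u) \<bullet> (?C *v u)" for u
  proof -
    define w where "w = matrix_inv ?A *v u"
    have "B *v (transpose B *v w) = u"
      using matrix_inv_mult_vector(1)[OF invA, of u]
      by (simp add: w_def matrix_vector_mul_assoc matrix_mul_assoc)
    then have "?C *v u = transpose B *v w"
      using matrix_inv_mult_vector(2)[OF assms] by metis
    then have "(?C *v u) \<bullet> (?C *v u) = (?C *v u) \<bullet> (transpose B *v w)" by simp
    also have "\<dots> = (B *v (?C *v u)) \<bullet> w" by (subst inner_matrix_vector_transpose) simp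
    finally show ?thesis
      using matrix_inv_mult_vector(1)[OF assms] by (simp add: w_def)
  qed
  have "surj ((*v) B)" using matrix_inv_mult_vector(1)[OF assms] by (metis surjI)
  then obtain c where c: "distr lborel borel ((*v) B) = density lborel (\<lambda>_. c)"
    using distr_lborel_linear[of "(*v) B"] by auto
  have "emeasure (distr std_gaussian borel ((*v) B)) S =
      emeasure (density lborel (\<lambda>u. c * ennreal (\<phi> (?C *v u)))) S"
    if [measurable]: "S \<in> sets borel" for S
  proof -
    have "emeasure (distr std_gaussian borel ((*v) B)) S = (\<integral>\<^sup>+z. indicator S (B *v z) * ennreal (\<phi> z) \<partial>lborel)"
    proof -
      have "emeasure (distr std_gaussian borel ((*v) B)) S =
          (\<integral>\<^sup>+u. indicator S u \<partial>distr std_gaussian borel ((*v) B))" by simp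
      also have "\<dots> = (\<integral>\<^sup>+z. indicator S (B *v z) \<partial>std_gaussian)"
        by (subst nn_integral_distr) auto
      finally show ?thesis
        unfolding std by (simp add: nn_integral_density mult.commute)
    qed
    also have "\<dots> = (\<integral>\<^sup>+z. indicator S (B *v z) * ennreal (\<phi> (?C *v (B *v z))) \<partial>lborel)"
      by (simp add: matrix_inv_mult_vector(2)[OF assms])
    also have "\<dots> = (\<integral>\<^sup>+u. indicator S u * ennreal (\<phi> (?C *v u)) \<partial>distr lborel borel ((*v) B))"
      by (subst nn_integral_distr) auto
    also have "\<dots> = (\<integral>\<^sup>+u. (c * ennreal (\<phi> (?C *v u))) * indicator S u \<partial>lborel)"
      unfolding c by (subst nn_integral_density) (auto simp: mult_ac)
    finally show ?thesis by (simp add: emeasure_density)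
  qed
  then have "distr std_gaussian borel (\<lambda>z. B *v z) = density lborel (\<lambda>u. c * ennreal (\<phi> (?C *v u)))"
    by (intro measure_eqI) auto
  also have "\<dots> = density lborel (\<lambda>u. (c * ennreal ((1 / sqrt (2 * pi)) ^ CARD('n))) * ennreal (gauss_kernel ?A u))"
    by (simp add: \<phi>_def gauss_kernel_def kern ennreal_mult mult.assoc)
  finally show ?thesis using that by blast
qed

lemma pos_definite_factor_invertible:
  fixes B :: "real ^ 'n ^ 'n"
  assumes "pos_definite (B ** transpose B)"
  shows "invertible B"
  using pos_definite_invertible[OF assms] unfolding invertible_def
  by (metis invertible_right_inverse invertible_def matrix_mul_assoc)

text \<open>A factor exists, so the \<open>SOME\<close> in the definition of \<open>gaussian\<close>
  does pick one, and the kernel is the same for all of them.\<close>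

lemma gaussian_density:
  fixes A :: "real ^ 'n ^ 'n"
  assumes "pos_definite A"
  obtains c :: ennreal where "gaussian 0 A = density lborel (\<lambda>u. c * ennreal (gauss_kernel A u))"
proof -
  define B where "B = (SOME B :: real ^ 'n ^ 'n. B ** transpose B = A)"
  have B: "B ** transpose B = A"
    unfolding B_def using pos_definite_factor[OF assms] by (rule someI_ex)
  then have "invertible B" using assms pos_definite_factor_invertible by metis
  from distr_std_gaussian_linear[OF this] obtain c where
    "distr std_gaussian borel (\<lambda>z. B *v z) = density lborel (\<lambda>u. c * ennreal (gauss_kernel A u))"
    unfolding B by blast
  with that show ?thesis by (simp add: gaussian_def B_def)
qed

lemma gaussian_eqI:
  fixes A :: "real ^ 'n ^ 'n"
  assumes "pos_definite A" and "prob_space P"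
    and "P = density lborel (\<lambda>u. c * ennreal (gauss_kernel A u))"
  shows "P = gaussian 0 A"
proof -
  obtain d where d: "gaussian 0 A = density lborel (\<lambda>u. d * ennreal (gauss_kernel A u))"
    using gaussian_density[OF assms(1)] .
  show ?thesis
    using assms(2) prob_space_gaussian[of 0 A] unfolding d assms(3)
    by (intro density_proportional_eq) auto
qed

lemma distr_gaussian_linear:
  fixes B :: "real ^ 'n ^ 'n"
  assumes "invertible B" and "pos_definite (B ** transpose B)"
  shows "distr std_gaussian borel (\<lambda>z. B *v z) = gaussian 0 (B ** transpose B)"
proof -
  obtain c where c: "distr std_gaussian borel (\<lambda>z. B *v z) =
      density lborel (\<lambda>u. c * ennreal (gauss_kernel (B ** transpose B) u))"
    using distr_std_gaussian_linear[OF assms(1)] .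
  have "prob_space (distr std_gaussian borel (\<lambda>z. B *v z))"
    by (rule prob_space.prob_space_distr[OF prob_space_std_gaussian]) measurable
  then show ?thesis using gaussian_eqI[OF assms(2) _ c] by blast
qed

lemma pos_definite_mat_1: "pos_definite (mat 1 :: real ^ 'n ^ 'n)"
  by (simp add: pos_definite_def)

lemma gaussian_mat_1: "gaussian 0 (mat 1) = (std_gaussian :: (real ^ 'n) measure)"
proof -
  have "invertible (mat 1 :: real ^ 'n ^ 'n)" by (simp add: invertible_def)
  moreover have "distr std_gaussian borel (\<lambda>z. z) = (std_gaussian :: (real ^ 'n) measure)"
    by (rule distr_id2) simp
  moreover have "pos_definite (mat 1 :: real ^ 'n ^ 'n)" by (rule pos_definite_mat_1)
  ultimately show ?thesis
    using distr_gaussian_linear[of "mat 1 :: real ^ 'n ^ 'n"] by simp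
qed

text \<open>Allows the rotation that the Taylor expansion applies to x to be dropped at the
  end.\<close>

lemma distr_std_gaussian_orthogonal:
  fixes B :: "real ^ 'n ^ 'n"
  assumes "orthogonal_matrix B"
  shows "distr std_gaussian borel (\<lambda>z. B *v z) = std_gaussian"
proof -
  have "B ** transpose B = mat 1" "invertible B"
    using assms unfolding orthogonal_matrix_def invertible_def by auto
  then show ?thesis
    using distr_gaussian_linear[of B] pos_definite_mat_1 by (simp add: gaussian_mat_1)
qed

lemma pos_definite_outer_plus:
  fixes E :: "real ^ 'm ^ 'n"
  assumes "s \<noteq> 0"
  shows "pos_definite (E ** transpose E + (s\<^sup>2) *\<^sub>R mat 1)"
proof -
  have "v \<bullet> ((E ** transpose E + (s\<^sup>2) *\<^sub>R mat 1) *v v) =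
      (transpose E *v v) \<bullet> (transpose E *v v) + s\<^sup>2 * (v \<bullet> v)" for v
    by (simp add: matrix_vector_mult_add_rdistrib matrix_scaleR_vector inner_add_right
        matrix_vector_mul_assoc[symmetric] inner_matrix_vector_transpose[of v E])
  moreover have "transpose (E ** transpose E + (s\<^sup>2) *\<^sub>R mat 1) = E ** transpose E + (s\<^sup>2) *\<^sub>R mat 1"
    by (simp add: vec_eq_iff transpose_def matrix_matrix_mult_def mat_def mult.commute)
  ultimately show ?thesis
    using assms unfolding pos_definite_def by (simp add: add_nonneg_pos)
qed

text \<open>
  Complete the square in \<open>x = E' w + y\<close> with \<open>w = A\<^sup>-\<^sup>1 u\<close>; normalizing constants need not be
  computed because both sides are probability measures.
\<close>
lemma gaussian_convolution:
  fixes E :: "real ^ 'm ^ 'n"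
  assumes s: "s \<noteq> 0"
  shows "distr (std_gaussian \<Otimes>\<^sub>M std_gaussian) borel (\<lambda>(x, z). E *v x + s *\<^sub>R z) =
    gaussian 0 (E ** transpose E + (s\<^sup>2) *\<^sub>R mat 1)"
proof -
  define A where "A = E ** transpose E + (s\<^sup>2) *\<^sub>R mat 1"
  have posA: "pos_definite A" unfolding A_def using s by (rule pos_definite_outer_plus)
  define p :: "real ^ 'm \<Rightarrow> real" where
    "p x = (1 / sqrt (2 * pi)) ^ CARD('m) * exp (- (x \<bullet> x) / 2)" for x
  define g :: "real ^ 'n \<Rightarrow> real" where
    "g z = (1 / sqrt (2 * pi)) ^ CARD('n) * exp (- (z \<bullet> z) / 2)" for z
  have g0: "0 \<le> g z" for z by (simp add: g_def)
  have [measurable]: "p \<in> borel_measurable borel" "g \<in> borel_measurable borel"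
    unfolding p_def g_def by measurable
  have stdm: "(std_gaussian :: (real ^ 'm) measure) = density lborel (\<lambda>z. ennreal (p z))"
    by (simp add: std_gaussian_alt p_def)
  have stdn: "(std_gaussian :: (real ^ 'n) measure) = density lborel (\<lambda>z. ennreal (g z))"
    by (simp add: std_gaussian_alt g_def)
  interpret pair_prob_space "std_gaussian :: (real ^ 'm) measure" "std_gaussian :: (real ^ 'n) measure"
    by (simp add: pair_prob_space_def pair_sigma_finite_def prob_space_std_gaussian
        prob_space_imp_sigma_finite)
  \<comment> \<open>The integral that is left once the square is completed. It is free of u, so that
    all dependence on u sits in \<open>gauss_kernel A u\<close>.\<close>
  define K where "K = (\<integral>\<^sup>+y. ennreal (exp (- ((y \<bullet> y) + (E *v y) \<bullet> (E *v y) / s\<^sup>2) / 2)) \<partial>(lborel :: (real ^ 'm) measure))"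
  define a where "a = ((1 / sqrt (2 * pi)) ^ CARD('m)) * ((1 / sqrt (2 * pi)) ^ CARD('n)) / \<bar>s\<bar> ^ CARD('n)"
  have a0: "0 \<le> a" by (simp add: a_def)
  have square: "x \<bullet> x + (u - E *v x) \<bullet> (u - E *v x) / s\<^sup>2 =
      u \<bullet> (matrix_inv A *v u) + ((y \<bullet> y) + (E *v y) \<bullet> (E *v y) / s\<^sup>2)"
    if x: "x = transpose E *v (matrix_inv A *v u) + y" for x y u
  proof -
    define w where "w = matrix_inv A *v u"
    have u: "u = E *v (transpose E *v w) + s\<^sup>2 *\<^sub>R w"
    proof -
      have "u = A *v w"
        unfolding w_def by (rule matrix_inv_mult_vector(1)[OF pos_definite_invertible[OF posA], symmetric])
      then show ?thesis
        by (simp add: A_def matrix_vector_mult_add_rdistrib matrix_scaleR_vector matrix_vector_mul_assoc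
            del: transpose_matrix_vector)
    qed
    have xw: "x = transpose E *v w + y" using x by (simp add: w_def)
    have 1: "u - E *v x = s\<^sup>2 *\<^sub>R w - E *v y"
      by (subst u) (simp add: xw matrix_vector_right_distrib)
    have 2: "u \<bullet> w = (transpose E *v w) \<bullet> (transpose E *v w) + s\<^sup>2 * (w \<bullet> w)"
    proof -
      have "u \<bullet> w = w \<bullet> (E *v (transpose E *v w) + s\<^sup>2 *\<^sub>R w)"
        using u by (metis inner_commute)
      also have "\<dots> = w \<bullet> (E *v (transpose E *v w)) + s\<^sup>2 * (w \<bullet> w)"
        by (simp only: inner_add_right inner_scaleR_right)
      finally show ?thesis by (simp only: inner_matrix_vector_transpose[of w E])
    qed
    have 3: "(transpose E *v w) \<bullet> y = w \<bullet> (E *v y)" by (rule inner_matrix_vector_transpose[symmetric])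
    have "(u - E *v x) \<bullet> (u - E *v x) / s\<^sup>2 =
       s\<^sup>2 * (w \<bullet> w) - 2 * (w \<bullet> (E *v y)) + (E *v y) \<bullet> (E *v y) / s\<^sup>2"
      unfolding 1 using s
      by (simp add: inner_diff_left inner_diff_right inner_commute[of "E *v y" w] field_simps power2_eq_square)
    moreover have "x \<bullet> x = (transpose E *v w) \<bullet> (transpose E *v w) + 2 * (w \<bullet> (E *v y)) + y \<bullet> y"
      unfolding xw using 3
      by (simp add: inner_add_left inner_add_right inner_commute[of y "transpose E *v w"]
          del: transpose_matrix_vector)
    ultimately show ?thesis using 2 by (simp add: w_def)
  qed
  have inner: "(\<integral>\<^sup>+x. ennreal (p x) * ennreal (g ((u - E *v x) /\<^sub>R s) / \<bar>s\<bar> ^ CARD('n)) \<partial>lborel) =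
      ennreal a * K * ennreal (gauss_kernel A u)" for u
  proof -
    let ?t = "transpose E *v (matrix_inv A *v u)"
    have e: "p x * (g ((u - E *v x) /\<^sub>R s) / \<bar>s\<bar> ^ CARD('n)) =
        a * exp (- (x \<bullet> x + (u - E *v x) \<bullet> (u - E *v x) / s\<^sup>2) / 2)" for x
    proof -
      define d where "d = u - E *v x"
      have "(d /\<^sub>R s) \<bullet> (d /\<^sub>R s) = d \<bullet> d / s\<^sup>2"
        by (simp add: power2_eq_square divide_inverse)
      then have "exp (- (x \<bullet> x + d \<bullet> d / s\<^sup>2) / 2) =
          exp (- (x \<bullet> x) / 2) * exp (- ((d /\<^sub>R s) \<bullet> (d /\<^sub>R s)) / 2)"
        by (simp only: exp_add[symmetric]) (simp add: add_divide_distrib)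
      then show ?thesis
        unfolding p_def g_def a_def d_def[symmetric] by (simp only: times_divide_eq_left times_divide_eq_right mult_ac)
    qed
    have "(\<integral>\<^sup>+x. ennreal (p x) * ennreal (g ((u - E *v x) /\<^sub>R s) / \<bar>s\<bar> ^ CARD('n)) \<partial>lborel) =
        (\<integral>\<^sup>+x. ennreal (a * exp (- (x \<bullet> x + (u - E *v x) \<bullet> (u - E *v x) / s\<^sup>2) / 2)) \<partial>lborel)"
      by (intro nn_integral_cong, subst e[symmetric], subst ennreal_mult) (auto simp: p_def g_def)
    also have "\<dots> = (\<integral>\<^sup>+x. ennreal (a * exp (- (x \<bullet> x + (u - E *v x) \<bullet> (u - E *v x) / s\<^sup>2) / 2)) \<partial>distr lborel borel ((+) ?t))"
      by (simp add: lborel_distr_plus)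
    also have "\<dots> = (\<integral>\<^sup>+y. ennreal (a * exp (- (u \<bullet> (matrix_inv A *v u) + ((y \<bullet> y) + (E *v y) \<bullet> (E *v y) / s\<^sup>2)) / 2)) \<partial>lborel)"
      by (subst nn_integral_distr, measurable) (simp only: square[OF refl])
    also have "\<dots> = (\<integral>\<^sup>+y. (ennreal a * ennreal (gauss_kernel A u)) * ennreal (exp (- ((y \<bullet> y) + (E *v y) \<bullet> (E *v y) / s\<^sup>2) / 2)) \<partial>lborel)"
      using a0 by (intro nn_integral_cong)
         (simp add: gauss_kernel_def ennreal_mult[symmetric] mult.assoc exp_add[symmetric] add_divide_distrib diff_divide_distrib)
    also have "\<dots> = (ennreal a * ennreal (gauss_kernel A u)) * K"
      unfolding K_def by (subst nn_integral_cmult) auto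
    finally show ?thesis by (simp add: mult_ac)
  qed
  have aff: "(\<integral>\<^sup>+z. ennreal (g z) * f (E *v x + s *\<^sub>R z) \<partial>lborel) =
      (\<integral>\<^sup>+u. ennreal (g ((u - E *v x) /\<^sub>R s) / \<bar>s\<bar> ^ CARD('n)) * f u \<partial>lborel)"
    if [measurable]: "f \<in> borel_measurable borel" for f :: "real ^ 'n \<Rightarrow> ennreal" and x
  proof -
    have "(\<integral>\<^sup>+u. ennreal (g ((u - E *v x) /\<^sub>R s) / \<bar>s\<bar> ^ CARD('n)) * f u \<partial>lborel) =
      (\<integral>\<^sup>+u. ennreal (g ((u - E *v x) /\<^sub>R s) / \<bar>s\<bar> ^ CARD('n)) * f u
        \<partial>density (distr lborel borel (\<lambda>z. E *v x + s *\<^sub>R z)) (\<lambda>_. ennreal (\<bar>s\<bar> ^ DIM(real ^ 'n))))"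
      by (subst lborel_affine[OF s, of "E *v x"]) simp
    also have "\<dots> = (\<integral>\<^sup>+z. ennreal (g z) * f (E *v x + s *\<^sub>R z) \<partial>lborel)"
      using s g0
      by (subst nn_integral_density)
         (auto simp: nn_integral_distr mult.assoc[symmetric] ennreal_mult[symmetric] intro!: nn_integral_cong)
    finally show ?thesis by simp
  qed
  let ?D = "distr (std_gaussian \<Otimes>\<^sub>M std_gaussian) borel (\<lambda>(x, z). E *v x + s *\<^sub>R z)"
  have "emeasure ?D S = emeasure (density lborel (\<lambda>u. (ennreal a * K) * ennreal (gauss_kernel A u))) S"
    if [measurable]: "S \<in> sets borel" for S
  proof -
    have "emeasure ?D S = (\<integral>\<^sup>+q. indicator S (E *v fst q + s *\<^sub>R snd q) \<partial>(std_gaussian \<Otimes>\<^sub>M std_gaussian))"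
    proof -
      have "emeasure ?D S = (\<integral>\<^sup>+u. indicator S u \<partial>?D)" by simp
      also have "\<dots> = (\<integral>\<^sup>+q. indicator S (E *v fst q + s *\<^sub>R snd q) \<partial>(std_gaussian \<Otimes>\<^sub>M std_gaussian))"
        by (subst nn_integral_distr) (auto simp: case_prod_beta')
      finally show ?thesis .
    qed
    also have "\<dots> = (\<integral>\<^sup>+x. \<integral>\<^sup>+z. indicator S (E *v x + s *\<^sub>R z) \<partial>std_gaussian \<partial>std_gaussian)"
      by (subst M2.nn_integral_fst[symmetric]) auto
    also have "\<dots> = (\<integral>\<^sup>+x. ennreal (p x) * (\<integral>\<^sup>+z. ennreal (g z) * indicator S (E *v x + s *\<^sub>R z) \<partial>lborel) \<partial>lborel)"
      by (simp add: stdm stdn nn_integral_density)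
    also have "\<dots> = (\<integral>\<^sup>+x. \<integral>\<^sup>+u. ennreal (p x) * ennreal (g ((u - E *v x) /\<^sub>R s) / \<bar>s\<bar> ^ CARD('n)) * indicator S u \<partial>lborel \<partial>lborel)"
      by (simp add: aff nn_integral_cmult[symmetric] mult.assoc)
    also have "\<dots> = (\<integral>\<^sup>+u. \<integral>\<^sup>+x. ennreal (p x) * ennreal (g ((u - E *v x) /\<^sub>R s) / \<bar>s\<bar> ^ CARD('n)) * indicator S u \<partial>lborel \<partial>lborel)"
      by (rule lborel_pair.Fubini') measurable
    also have "\<dots> = (\<integral>\<^sup>+u. (ennreal a * K * ennreal (gauss_kernel A u)) * indicator S u \<partial>lborel)"
      by (simp add: inner nn_integral_multc)
    finally show ?thesis by (simp add: emeasure_density)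
  qed
  then have "?D = density lborel (\<lambda>u. (ennreal a * K) * ennreal (gauss_kernel A u))"
    by (intro measure_eqI) auto
  moreover have "prob_space ?D"
    by (rule prob_space_distr) measurable
  ultimately show ?thesis
    unfolding A_def[symmetric] by (rule gaussian_eqI[OF posA, rotated])
qed

section \<open>Continuity of the Gaussian law in its covariance\<close>

lemma matrix_inv_unique:
  fixes A B :: "real ^ 'n ^ 'n"
  assumes "A ** B = mat 1"
  shows "matrix_inv A = B"
proof -
  have "B ** A = mat 1" using assms by (simp add: matrix_left_right_inverse)
  then have "invertible A" using assms by (auto simp: invertible_def)
  then have "matrix_inv A = matrix_inv A ** (A ** B)" using assms by simp
  also have "\<dots> = B" using \<open>invertible A\<close> by (simp add: matrix_mul_assoc invertible_matrix_inv)
  finally show ?thesis .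
qed

lemma matrix_mult_scaleR:
  fixes A :: "real ^ 'm ^ 'n" and B :: "real ^ 'p ^ 'm"
  shows "(c *\<^sub>R A) ** B = c *\<^sub>R (A ** B)" "A ** (c *\<^sub>R B) = c *\<^sub>R (A ** B)"
  by (simp_all add: vec_eq_iff matrix_matrix_mult_def sum_distrib_left mult_ac)

lemma tendsto_det:
  fixes f :: "'a \<Rightarrow> real ^ 'n ^ 'n"
  assumes "(f \<longlongrightarrow> A) F"
  shows "((\<lambda>x. det (f x)) \<longlongrightarrow> det A) F"
  unfolding det_def by (intro tendsto_intros assms)

text \<open>Cramer's rule for the system A x = e_l. Both determinants are polynomials in the entries
  of A, which is what makes inversion continuous.\<close>

lemma matrix_inv_nth:
  fixes A :: "real ^ 'n ^ 'n"
  assumes "det A \<noteq> 0"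
  shows "matrix_inv A $ k $ l =
    det (\<chi> i j. if j = k then (if i = l then 1 else 0) else A $ i $ j) / det A"
proof -
  have "invertible A" using assms by (simp add: invertible_det_nz)
  then have "A *v (matrix_inv A *v axis l 1) = axis l 1" by (simp add: matrix_inv_mult_vector)
  then have "matrix_inv A *v axis l 1 =
      (\<chi> k. det (\<chi> i j. if j = k then (axis l 1 :: real ^ 'n) $ i else A $ i $ j) / det A)"
    by (subst (asm) cramer[OF assms])
  then have "(matrix_inv A *v axis l 1) $ k =
      det (\<chi> i j. if j = k then (axis l 1 :: real ^ 'n) $ i else A $ i $ j) / det A"
    by simp
  moreover have "(axis l 1 :: real ^ 'n) $ i = (if i = l then 1 else 0)" for i
    by (simp add: axis_def)
  ultimately show ?thesis
    by (simp add: matrix_vector_mult_basis column_def cong: if_cong)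
qed

lemma tendsto_matrix_inv:
  fixes f :: "'a \<Rightarrow> real ^ 'n ^ 'n"
  assumes f: "(f \<longlongrightarrow> A) F" and A: "det A \<noteq> 0"
  shows "((\<lambda>x. matrix_inv (f x)) \<longlongrightarrow> matrix_inv A) F"
proof (intro vec_tendstoI)
  fix k l
  let ?M = "\<lambda>B :: real ^ 'n ^ 'n. (\<chi> i j. if j = k then (if i = l then 1 else 0) else B $ i $ j) :: real ^ 'n ^ 'n"
  have "((\<lambda>x. ?M (f x)) \<longlongrightarrow> ?M A) F"
    by (intro tendsto_vec_lambda) (auto intro!: tendsto_intros f)
  then have "((\<lambda>x. det (?M (f x)) / det (f x)) \<longlongrightarrow> det (?M A) / det A) F"
    by (intro tendsto_divide tendsto_det f A)
  then have "((\<lambda>x. det (?M (f x)) / det (f x)) \<longlongrightarrow> matrix_inv A $ k $ l) F"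
    by (simp add: matrix_inv_nth[OF A])
  moreover have "eventually (\<lambda>x. det (f x) \<noteq> 0) F"
    using tendsto_det[OF f] A by (rule tendsto_imp_eventually_ne)
  then have "eventually (\<lambda>x. det (?M (f x)) / det (f x) = matrix_inv (f x) $ k $ l) F"
    by eventually_elim (simp add: matrix_inv_nth)
  ultimately show "((\<lambda>x. matrix_inv (f x) $ k $ l) \<longlongrightarrow> matrix_inv A $ k $ l) F"
    by (rule Lim_transform_eventually)
qed

lemma tendsto_matrix_vector_mult:
  fixes f :: "'a \<Rightarrow> real ^ 'm ^ 'n"
  assumes "(f \<longlongrightarrow> A) F" and "(g \<longlongrightarrow> x) F"
  shows "((\<lambda>t. f t *v g t) \<longlongrightarrow> A *v x) F"
  unfolding matrix_vector_mult_def
  by (intro tendsto_vec_lambda tendsto_intros assms)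

text \<open>\<open>\<kappa>\<close> is the minimum of the form on the compact unit sphere;
  homogeneity extends the bound to all vectors.\<close>

lemma pos_definite_lower_bound:
  fixes A :: "real ^ 'n ^ 'n"
  assumes "pos_definite A"
  obtains \<kappa> where "0 < \<kappa>" and "\<And>u. \<kappa> * (u \<bullet> u) \<le> u \<bullet> (A *v u)"
proof -
  have "continuous_on (sphere 0 1) (\<lambda>u. u \<bullet> (A *v u))"
    by (intro continuous_intros linear_continuous_on matrix_vector_mul_bounded_linear)
  moreover have "sphere 0 1 \<noteq> ({} :: (real ^ 'n) set)" by simp
  ultimately obtain u0 where u0: "u0 \<in> sphere 0 1"
    and min: "\<And>u. u \<in> sphere 0 1 \<Longrightarrow> u0 \<bullet> (A *v u0) \<le> u \<bullet> (A *v u)"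
    using continuous_attains_inf[OF compact_sphere, of 0 1 "\<lambda>u. u \<bullet> (A *v u)"] by blast
  show thesis
  proof (rule that)
    show "0 < u0 \<bullet> (A *v u0)" using u0 assms unfolding pos_definite_def by (metis dist_0_norm mem_sphere norm_zero zero_neq_one)
    fix u :: "real ^ 'n"
    show "(u0 \<bullet> (A *v u0)) * (u \<bullet> u) \<le> u \<bullet> (A *v u)"
    proof (cases "u = 0")
      case False
      define v where "v = u /\<^sub>R norm u"
      have u: "u = norm u *\<^sub>R v" using False by (simp add: v_def)
      have v: "v \<in> sphere 0 1" using False by (simp add: v_def)
      have "u \<bullet> (A *v u) = (norm u)\<^sup>2 * (v \<bullet> (A *v v))"
        by (subst (1 2) u) (simp add: matrix_vector_mult_scaleR power2_eq_square)
      then show ?thesis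
        using mult_left_mono[OF min[OF v], of "(norm u)\<^sup>2"] by (simp add: dot_square_norm mult.commute)
    qed simp
  qed
qed

lemma pos_definite_matrix_inv:
  fixes A :: "real ^ 'n ^ 'n"
  assumes "pos_definite A"
  shows "pos_definite (matrix_inv A)"
proof -
  have inv: "invertible A" by (rule pos_definite_invertible[OF assms])
  have sym: "transpose A = A" using assms by (simp add: pos_definite_def)
  have "A ** transpose (matrix_inv A) = mat 1"
    by (metis inv invertible_matrix_inv(2) matrix_transpose_mul sym transpose_mat)
  then have "transpose (matrix_inv A) = matrix_inv A" by (metis matrix_inv_unique)
  moreover have "0 < v \<bullet> (matrix_inv A *v v)" if "v \<noteq> 0" for v
  proof -
    define w where "w = matrix_inv A *v v"
    have v: "v = A *v w" using matrix_inv_mult_vector(1)[OF inv] by (simp add: w_def)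
    then have "w \<noteq> 0" using that by auto
    then have "0 < w \<bullet> (A *v w)" using assms by (simp add: pos_definite_def)
    then show ?thesis by (simp add: v[symmetric] w_def[symmetric] inner_commute)
  qed
  ultimately show ?thesis by (simp add: pos_definite_def)
qed

lemma pos_definite_scaleR:
  fixes A :: "real ^ 'n ^ 'n"
  assumes "pos_definite A" and "0 < c"
  shows "pos_definite (c *\<^sub>R A)"
  using assms by (simp add: pos_definite_def matrix_scaleR_vector transpose_scalar)

text \<open>No Gaussian integral is evaluated. The law has total mass one, so c I = 1 for the mass I
  of the kernel; this forces I to be finite and positive and then eliminates
  \<open>c\<close>.\<close>

lemma integrable_gauss_kernel:
  fixes A :: "real ^ 'n ^ 'n"
  assumes "pos_definite A"
  shows "integrable lborel (gauss_kernel A)"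
    and "S \<in> sets borel \<Longrightarrow> measure (gaussian 0 A) S =
      (\<integral>u. indicator S u * gauss_kernel A u \<partial>lborel) / (\<integral>u. gauss_kernel A u \<partial>lborel)"
proof -
  obtain c where c: "gaussian 0 A = density lborel (\<lambda>u. c * ennreal (gauss_kernel A u))"
    using gaussian_density[OF assms] .
  define I where "I = (\<integral>\<^sup>+u. ennreal (gauss_kernel A u) \<partial>lborel)"
  have cI: "c * I = 1"
    using prob_space.emeasure_space_1[OF prob_space_gaussian[of 0 A]]
    by (simp add: c emeasure_density nn_integral_cmult I_def)
  then have "I \<noteq> \<infinity>" by (auto simp: ennreal_mult_top split: if_splits)
  then show int: "integrable lborel (gauss_kernel A)"
    unfolding I_def by (intro integrableI_nonneg) (auto simp: less_imp_le[OF gauss_kernel_pos] less_top)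
  have I: "I = ennreal (\<integral>u. gauss_kernel A u \<partial>lborel)"
    unfolding I_def using int by (intro nn_integral_eq_integral) (auto simp: less_imp_le[OF gauss_kernel_pos])
  then have pos: "0 < (\<integral>u. gauss_kernel A u \<partial>lborel)"
    using cI by (metis ennreal_eq_0_iff linorder_not_le mult_zero_right zero_neq_one)
  assume [measurable]: "S \<in> sets borel"
  have ints: "integrable lborel (\<lambda>u. indicator S u * gauss_kernel A u)"
    using int by (simp add: integrable_mult_indicator[where 'b = real, simplified] integrable_real_mult_indicator mult.commute)
  have "emeasure (gaussian 0 A) S = c * (\<integral>\<^sup>+u. ennreal (indicator S u * gauss_kernel A u) \<partial>lborel)"
    by (simp add: c emeasure_density nn_integral_cmult[symmetric] mult.assoc)
       (intro nn_integral_cong, simp split: split_indicator)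
  also have "(\<integral>\<^sup>+u. ennreal (indicator S u * gauss_kernel A u) \<partial>lborel) =
      ennreal (\<integral>u. indicator S u * gauss_kernel A u \<partial>lborel)"
    using ints by (intro nn_integral_eq_integral) (auto simp: less_imp_le[OF gauss_kernel_pos])
  finally have "I * emeasure (gaussian 0 A) S =
      (c * I) * ennreal (\<integral>u. indicator S u * gauss_kernel A u \<partial>lborel)"
    by (simp add: mult_ac)
  then have "ennreal (\<integral>u. gauss_kernel A u \<partial>lborel) * emeasure (gaussian 0 A) S =
      ennreal (\<integral>u. indicator S u * gauss_kernel A u \<partial>lborel)"
    unfolding cI by (simp add: I)
  moreover have "emeasure (gaussian 0 A) S = ennreal (measure (gaussian 0 A) S)"
    by (intro finite_measure.emeasure_eq_measure prob_space.finite_measure prob_space_gaussian)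
  ultimately have "(\<integral>u. gauss_kernel A u \<partial>lborel) * measure (gaussian 0 A) S =
      (\<integral>u. indicator S u * gauss_kernel A u \<partial>lborel)"
    using pos by (simp add: ennreal_mult[symmetric] integral_nonneg_AE less_imp_le[OF gauss_kernel_pos])
  then show "measure (gaussian 0 A) S =
      (\<integral>u. indicator S u * gauss_kernel A u \<partial>lborel) / (\<integral>u. gauss_kernel A u \<partial>lborel)"
    using pos by (simp add: field_simps)
qed

text \<open>If the integral vanished, the quotient formula for \<open>UNIV\<close> would read 1 = 0,
  because x / 0 = 0.\<close>

lemma integral_gauss_kernel_pos:
  fixes A :: "real ^ 'n ^ 'n"
  assumes "pos_definite A"
  shows "0 < (\<integral>u. gauss_kernel A u \<partial>lborel)"
  using integrable_gauss_kernel(2)[OF assms, of UNIV] 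
    prob_space.prob_space[OF prob_space_gaussian[of 0 A]] integral_nonneg_AE[of "gauss_kernel A" lborel]
  by (cases "(\<integral>u. gauss_kernel A u \<partial>lborel) = 0") (auto simp: less_imp_le[OF gauss_kernel_pos] less_le)

lemma quadratic_form_bound:
  fixes D :: "real ^ 'n ^ 'n"
  shows "\<bar>u \<bullet> (D *v u)\<bar> \<le> (\<Sum>i\<in>UNIV. \<Sum>j\<in>UNIV. \<bar>D $ i $ j\<bar>) * (u \<bullet> u)"
proof -
  have "u \<bullet> (D *v u) = (\<Sum>i\<in>UNIV. \<Sum>j\<in>UNIV. u $ i * D $ i $ j * u $ j)"
    by (simp add: inner_vec_def matrix_vector_mult_def sum_distrib_left mult.assoc)
  also have "\<bar>\<dots>\<bar> \<le> (\<Sum>i\<in>UNIV. \<Sum>j\<in>UNIV. \<bar>u $ i * D $ i $ j * u $ j\<bar>)"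
    by (rule order_trans[OF sum_abs]) (intro sum_mono sum_abs)
  also have "\<dots> \<le> (\<Sum>i\<in>UNIV. \<Sum>j\<in>UNIV. \<bar>D $ i $ j\<bar> * (u \<bullet> u))"
  proof (intro sum_mono)
    fix i j
    have "\<bar>u $ i\<bar> * \<bar>u $ j\<bar> \<le> norm u * norm u"
      by (intro mult_mono component_le_norm_cart) auto
    then have "\<bar>D $ i $ j\<bar> * (\<bar>u $ i\<bar> * \<bar>u $ j\<bar>) \<le> \<bar>D $ i $ j\<bar> * (norm u * norm u)"
      by (intro mult_left_mono) auto
    then show "\<bar>u $ i * D $ i $ j * u $ j\<bar> \<le> \<bar>D $ i $ j\<bar> * (u \<bullet> u)"
      by (simp add: abs_mult dot_square_norm power2_eq_square mult_ac)
  qed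
  finally show ?thesis by (simp add: sum_distrib_right)
qed

text \<open>No condition on the boundary of \<open>S\<close> is needed because the kernels
  themselves converge, under an integrable bound. The bound is the kernel of twice the limit:
  eventually the form of the inverse of \<open>A m\<close> is at least half that of the inverse of
  \<open>A0\<close>.\<close>

lemma measure_gaussian_tendsto:
  fixes A :: "nat \<Rightarrow> real ^ 'n ^ 'n"
  assumes lim: "A \<longlonglongrightarrow> A0" and pd: "\<And>m. pos_definite (A m)" and pd0: "pos_definite A0"
    and [measurable]: "S \<in> sets borel"
  shows "(\<lambda>m. measure (gaussian 0 (A m)) S) \<longlonglongrightarrow> measure (gaussian 0 A0) S"
proof -
  have det0: "det A0 \<noteq> 0" using pos_definite_invertible[OF pd0] by (simp add: invertible_det_nz)
  have inv: "(\<lambda>m. matrix_inv (A m)) \<longlonglongrightarrow> matrix_inv A0"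
    by (rule tendsto_matrix_inv[OF lim det0])
  have ptw: "(\<lambda>m. gauss_kernel (A m) u) \<longlonglongrightarrow> gauss_kernel A0 u" for u
    unfolding gauss_kernel_def by (intro tendsto_intros tendsto_matrix_vector_mult inv) simp
  obtain \<kappa> where \<kappa>: "0 < \<kappa>" "\<And>u. \<kappa> * (u \<bullet> u) \<le> u \<bullet> (matrix_inv A0 *v u)"
    using pos_definite_lower_bound[OF pos_definite_matrix_inv[OF pd0]] by blast
  have "(\<lambda>m. \<Sum>i\<in>UNIV. \<Sum>j\<in>UNIV. \<bar>(matrix_inv (A m) - matrix_inv A0) $ i $ j\<bar>) \<longlonglongrightarrow>
      (\<Sum>i\<in>UNIV. \<Sum>j\<in>UNIV. \<bar>(matrix_inv A0 - matrix_inv A0) $ i $ j\<bar>)"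
    by (intro tendsto_intros inv)
  \<comment> \<open>An error of at most \<open>\<kappa> / 2\<close> per unit of u'u is at most half
    of the limiting form; hence the factor 2 in the dominating kernel.\<close>
  then have "eventually (\<lambda>m. (\<Sum>i\<in>UNIV. \<Sum>j\<in>UNIV. \<bar>(matrix_inv (A m) - matrix_inv A0) $ i $ j\<bar>) < \<kappa> / 2) sequentially"
    using \<kappa>(1) by (intro order_tendstoD(2)) auto
  then obtain m0 where m0: "\<And>m. m \<ge> m0 \<Longrightarrow>
      (\<Sum>i\<in>UNIV. \<Sum>j\<in>UNIV. \<bar>(matrix_inv (A m) - matrix_inv A0) $ i $ j\<bar>) < \<kappa> / 2"
    by (auto simp: eventually_sequentially)
  have dom: "gauss_kernel (A (m + m0)) u \<le> gauss_kernel (2 *\<^sub>R A0) u" for m u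
  proof -
    let ?D = "matrix_inv (A (m + m0)) - matrix_inv A0"
    have "\<bar>u \<bullet> (?D *v u)\<bar> \<le> \<kappa> / 2 * (u \<bullet> u)"
      using m0[of "m + m0"] by (intro order_trans[OF quadratic_form_bound] mult_right_mono) auto
    moreover have "u \<bullet> (?D *v u) = u \<bullet> (matrix_inv (A (m + m0)) *v u) - u \<bullet> (matrix_inv A0 *v u)"
      by (simp add: matrix_vector_mult_diff_rdistrib inner_diff_right)
    moreover have "matrix_inv (2 *\<^sub>R A0) = (1/2) *\<^sub>R matrix_inv A0"
      by (rule matrix_inv_unique)
         (simp add: invertible_matrix_inv[OF pos_definite_invertible[OF pd0]] matrix_mult_scaleR)
    moreover have "u \<bullet> (matrix_inv A0 *v u) \<le> 2 * (u \<bullet> (matrix_inv (A (m + m0)) *v u))"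
      if "\<bar>u \<bullet> (?D *v u)\<bar> \<le> \<kappa> / 2 * (u \<bullet> u)"
        and "u \<bullet> (?D *v u) = u \<bullet> (matrix_inv (A (m + m0)) *v u) - u \<bullet> (matrix_inv A0 *v u)"
      using that \<kappa>(2)[of u] by linarith
    ultimately show ?thesis
      by (simp add: gauss_kernel_def matrix_scaleR_vector)
  qed
  have conv: "(\<lambda>m. \<integral>u. indicator T u * gauss_kernel (A (m + m0)) u \<partial>lborel) \<longlonglongrightarrow>
      (\<integral>u. indicator T u * gauss_kernel A0 u \<partial>lborel)"
    if [measurable]: "T \<in> sets borel" for T :: "(real ^ 'n) set"
  proof (rule integral_dominated_convergence[where w = "gauss_kernel (2 *\<^sub>R A0)"])
    show "integrable lborel (gauss_kernel (2 *\<^sub>R A0))"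
      by (intro integrable_gauss_kernel pos_definite_scaleR pd0) simp
    show "AE u in lborel. (\<lambda>m. indicator T u * gauss_kernel (A (m + m0)) u) \<longlonglongrightarrow> indicator T u * gauss_kernel A0 u"
      by (intro AE_I2 tendsto_intros LIMSEQ_ignore_initial_segment ptw)
    show "AE u in lborel. norm (indicator T u * gauss_kernel (A (m + m0)) u) \<le> gauss_kernel (2 *\<^sub>R A0) u" for m
      using dom less_imp_le[OF gauss_kernel_pos] by (intro AE_I2) (auto split: split_indicator)
  qed measurable
  have "(\<lambda>m. (\<integral>u. indicator S u * gauss_kernel (A (m + m0)) u \<partial>lborel) / (\<integral>u. gauss_kernel (A (m + m0)) u \<partial>lborel)) \<longlonglongrightarrow>
      (\<integral>u. indicator S u * gauss_kernel A0 u \<partial>lborel) / (\<integral>u. gauss_kernel A0 u \<partial>lborel)"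
    using conv[of S] conv[of UNIV] integral_gauss_kernel_pos[OF pd0] by (intro tendsto_divide) auto
  then have "(\<lambda>m. measure (gaussian 0 (A (m + m0))) S) \<longlonglongrightarrow> measure (gaussian 0 A0) S"
    by (simp add: integrable_gauss_kernel(2)[OF pd] integrable_gauss_kernel(2)[OF pd0])
  then show ?thesis by (rule LIMSEQ_offset)
qed

subsection \<open>Spectral densities\<close>

text \<open>The squared modulus, at z = e^(-i \<omega>), of (1 - r e^(i \<theta>) z) (1 - r e^(-i
  \<theta>) z). The coefficients of the autoregression are a1 = 2 r cos \<theta> and a2 = - r^2, and
  its roots tend to the unit circle as r tends to 1. The unsimplified form matches
  \<open>F_AR2\<close>.\<close>

definition ar2_gain :: "real \<Rightarrow> real \<Rightarrow> real \<Rightarrow> real" where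
  "ar2_gain r \<theta> \<omega> = (norm (1 - of_real (2 * r * cos \<theta>) * exp (- (\<i> * of_real \<omega>))
      - of_real (- r\<^sup>2) * exp (- (2 * \<i> * of_real \<omega>)))) ^ 2"

text \<open>Pulling out the factor e^(-i \<omega>) of modulus one leaves a number whose real and
  imaginary parts are the two squared terms.\<close>

lemma ar2_gain_eq:
  "ar2_gain r \<theta> \<omega> = ((1 + r\<^sup>2) * cos \<omega> - 2 * r * cos \<theta>)\<^sup>2 + ((1 - r\<^sup>2) * sin \<omega>)\<^sup>2"
proof -
  have e2: "exp (- (2 * \<i> * of_real \<omega>)) = exp (- (\<i> * of_real \<omega>)) * exp (- (\<i> * of_real \<omega>))"
    unfolding exp_add[symmetric] by (simp add: algebra_simps)
  have "1 - of_real (2 * r * cos \<theta>) * exp (- (\<i> * of_real \<omega>)) - of_real (- r\<^sup>2) * exp (- (2 * \<i> * of_real \<omega>)) =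
     exp (- (\<i> * of_real \<omega>)) *
       (exp (\<i> * of_real \<omega>) - of_real (2 * r * cos \<theta>) + of_real (r\<^sup>2) * exp (- (\<i> * of_real \<omega>)))"
    unfolding e2 by (simp add: algebra_simps exp_minus_inverse mult_exp_exp)
  then have "norm (1 - of_real (2 * r * cos \<theta>) * exp (- (\<i> * of_real \<omega>)) - of_real (- r\<^sup>2) * exp (- (2 * \<i> * of_real \<omega>))) =
     norm (exp (\<i> * of_real \<omega>) - of_real (2 * r * cos \<theta>) + of_real (r\<^sup>2) * exp (- (\<i> * of_real \<omega>)))"
    by (simp add: norm_mult)
  also have "\<dots> ^ 2 = ((1 + r\<^sup>2) * cos \<omega> - 2 * r * cos \<theta>)\<^sup>2 + ((1 - r\<^sup>2) * sin \<omega>)\<^sup>2"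
    unfolding cmod_power2 by (simp add: Re_exp Im_exp algebra_simps)
  finally show ?thesis by (simp add: ar2_gain_def)
qed

lemma ar2_polynomial_nonzero:
  fixes z :: complex
  assumes "0 < r" "r < 1" "norm z \<le> 1"
  shows "1 - of_real (2 * r * cos \<theta>) * z - of_real (- r\<^sup>2) * z ^ 2 \<noteq> 0"
proof -
  have "1 - of_real (2 * r * cos \<theta>) * z - of_real (- r\<^sup>2) * z ^ 2 =
      (1 - of_real r * cis \<theta> * z) * (1 - of_real r * cis (- \<theta>) * z)"
  proof -
    have "cis \<theta> * cis (- \<theta>) = 1" by (simp add: cis_mult)
    moreover have "cis \<theta> + cis (- \<theta>) = 2 * of_real (cos \<theta>)" by (simp add: complex_eq_iff)
    moreover have "(1 - R * a * z) * (1 - R * b * z) = 1 - R * (a + b) * z + R\<^sup>2 * (a * b) * z\<^sup>2"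
      for R a b :: complex by (simp add: algebra_simps power2_eq_square)
    ultimately have "(1 - of_real r * cis \<theta> * z) * (1 - of_real r * cis (- \<theta>) * z) =
        1 - of_real r * (2 * of_real (cos \<theta>)) * z + (of_real r)\<^sup>2 * z\<^sup>2"
      by (simp only: mult_1_right)
    then show ?thesis by (simp add: mult_ac)
  qed
  moreover have "1 - of_real r * cis t * z \<noteq> 0" for t
  proof
    assume "1 - of_real r * cis t * z = 0"
    then have "norm (of_real r * cis t * z) = 1" by simp
    then have "r * norm z = 1" using assms by (simp add: norm_mult)
    moreover have "r * norm z \<le> r * 1" using assms by (intro mult_left_mono) auto
    ultimately show False using assms by simp
  qed
  ultimately show ?thesis by simp
qed

lemma ar2_gain_pos:
  assumes "0 < r" "r < 1"
  shows "0 < ar2_gain r \<theta> \<omega>"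
proof -
  have "exp (- (2 * \<i> * of_real \<omega>)) = exp (- (\<i> * of_real \<omega>)) ^ 2"
    by (simp add: exp_double[symmetric] mult.assoc)
  then show ?thesis
    using ar2_polynomial_nonzero[OF assms, of "exp (- (\<i> * of_real \<omega>))" \<theta>]
    unfolding ar2_gain_def by simp
qed

lemma continuous_on_ar2_gain: "continuous_on S (ar2_gain r \<theta>)"
  unfolding ar2_gain_eq[abs_def] by (intro continuous_intros)

text \<open>Normalizing to total mass one amounts to an innovation variance of 2 \<pi> divided by
  the integral.\<close>

definition ar2_density :: "real \<Rightarrow> real \<Rightarrow> real \<Rightarrow> real" where
  "ar2_density r \<theta> = (\<lambda>\<omega>\<in>{-pi..pi}. 1 / (integral {-pi..pi} (\<lambda>\<omega>. 1 / ar2_gain r \<theta> \<omega>) * ar2_gain r \<theta> \<omega>))"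

lemma continuous_on_inverse_ar2_gain:
  assumes "0 < r" "r < 1" "continuous_on S g"
  shows "continuous_on S (\<lambda>\<omega>. g \<omega> / ar2_gain r \<theta> \<omega>)"
proof (rule continuous_on_divide[OF assms(3) continuous_on_ar2_gain])
  show "\<forall>\<omega>\<in>S. ar2_gain r \<theta> \<omega> \<noteq> 0"
    using ar2_gain_pos[OF assms(1,2), of \<theta>] by (simp add: less_imp_neq[THEN not_sym])
qed

text \<open>Shows how fast the normalizing integral grows as r tends to 1. To the left of \<theta>,
  up to distance 1 - r, the gain is at most 13 (1 - r)^2, with 13 = 3^2 + 2^2 from its two squares,
  and this interval has length 1 - r. The bounds on \<theta> keep it inside [-\<pi>, \<pi>].\<close>

lemma integral_inverse_ar2_gain_ge:
  assumes "0 < r" "r < 1" "1 - r \<le> \<theta>" "\<theta> < pi"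
  shows "1 / (13 * (1 - r)) \<le> integral {-pi..pi} (\<lambda>\<omega>. 1 / ar2_gain r \<theta> \<omega>)"
proof -
  let ?h = "\<lambda>\<omega>. 1 / ar2_gain r \<theta> \<omega>"
  have cont: "continuous_on S ?h" for S
    by (intro continuous_on_inverse_ar2_gain assms continuous_intros)
  have bound: "1 / (13 * (1 - r)\<^sup>2) \<le> ?h \<omega>" if "\<omega> \<in> {\<theta> - (1 - r)..\<theta>}" for \<omega>
  proof -
    have "\<bar>cos \<omega> - cos \<theta>\<bar> \<le> \<bar>\<omega> - \<theta>\<bar>"
    proof -
      have "\<bar>cos \<omega> - cos \<theta>\<bar> = 2 * (\<bar>sin ((\<omega> + \<theta>) / 2)\<bar> * \<bar>sin ((\<theta> - \<omega>) / 2)\<bar>)"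
        by (simp add: cos_diff_cos abs_mult)
      also have "\<dots> \<le> 2 * (1 * \<bar>(\<theta> - \<omega>) / 2\<bar>)"
        by (intro mult_left_mono mult_mono abs_sin_x_le_abs_x) auto
      finally show ?thesis by simp
    qed
    also have "\<dots> \<le> 1 - r" using that by auto
    finally have "\<bar>2 * r * (cos \<omega> - cos \<theta>)\<bar> \<le> 2 * (1 * (1 - r))"
      unfolding abs_mult mult.assoc using assms by (intro mult_mono) auto
    moreover have "\<bar>(1 - r)\<^sup>2 * cos \<omega>\<bar> \<le> (1 - r) * 1"
      unfolding abs_mult using assms by (intro mult_mono) (auto simp: power2_eq_square mult_left_le)
    \<comment> \<open>Writing 1 + r^2 = 2 r + (1 - r)^2 splits the left side into the two terms just
      bounded.\<close>
    ultimately have "\<bar>(1 + r\<^sup>2) * cos \<omega> - 2 * r * cos \<theta>\<bar> \<le> 3 * (1 - r)"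
      by (simp add: power2_eq_square algebra_simps abs_le_iff)
    then have "((1 + r\<^sup>2) * cos \<omega> - 2 * r * cos \<theta>)\<^sup>2 \<le> (3 * (1 - r))\<^sup>2"
      by (rule power2_le_iff_abs_le[THEN iffD2, rotated]) (use assms in auto)
    moreover have "((1 - r\<^sup>2) * sin \<omega>)\<^sup>2 \<le> (2 * (1 - r))\<^sup>2"
    proof -
      have "\<bar>(1 - r\<^sup>2) * sin \<omega>\<bar> \<le> (2 * (1 - r)) * 1"
      proof -
        have "1 - r\<^sup>2 = (1 + r) * (1 - r)" by (simp add: power2_eq_square algebra_simps)
        moreover have "(1 + r) * (1 - r) \<le> 2 * (1 - r)" using assms by (intro mult_right_mono) auto
        moreover have "0 \<le> (1 + r) * (1 - r)" using assms by simp
        ultimately show ?thesis unfolding abs_mult by (intro mult_mono) auto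
      qed
      then show ?thesis
        by (intro power2_le_iff_abs_le[THEN iffD2, rotated]) (use assms in auto)
    qed
    ultimately have "ar2_gain r \<theta> \<omega> \<le> 13 * (1 - r)\<^sup>2"
      unfolding ar2_gain_eq power_mult_distrib[of 3] power_mult_distrib[of 2] by simp
    then show ?thesis
      using ar2_gain_pos[OF assms(1,2), of \<theta> \<omega>] assms(2) by (intro divide_left_mono) auto
  qed
  have "1 / (13 * (1 - r)) = integral {\<theta> - (1 - r)..\<theta>} (\<lambda>\<omega>. 1 / (13 * (1 - r)\<^sup>2))"
    using assms by (simp add: power2_eq_square)
  also have "\<dots> \<le> integral {\<theta> - (1 - r)..\<theta>} ?h"
    by (intro integral_le bound integrable_continuous_interval cont continuous_intros) auto
  also have "\<dots> \<le> integral {-pi..pi} ?h"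
    using assms ar2_gain_pos[OF assms(1,2), of \<theta>]
    by (intro integral_subset_le integrable_continuous_interval cont) (auto simp: less_imp_le)
  finally show ?thesis .
qed

lemma integral_inverse_ar2_gain_pos:
  assumes "0 < r" "r < 1" 
  shows "0 < integral {-pi..pi} (\<lambda>\<omega>. 1 / ar2_gain r \<theta> \<omega>)"
proof -
  have cont: "continuous_on {-pi..pi} (\<lambda>\<omega>. 1 / ar2_gain r \<theta> \<omega>)"
    by (intro continuous_on_inverse_ar2_gain assms continuous_intros)
  then have "0 \<le> integral {-pi..pi} (\<lambda>\<omega>. 1 / ar2_gain r \<theta> \<omega>)"
    using ar2_gain_pos[OF assms, of \<theta>] by (intro integral_nonneg integrable_continuous_interval) (auto simp: less_imp_le)
  moreover have "integral {-pi..pi} (\<lambda>\<omega>. 1 / ar2_gain r \<theta> \<omega>) \<noteq> 0"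
  proof
    assume "integral {-pi..pi} (\<lambda>\<omega>. 1 / ar2_gain r \<theta> \<omega>) = 0"
    then have "\<forall>\<omega>\<in>{-pi..pi}. 1 / ar2_gain r \<theta> \<omega> = 0"
      using ar2_gain_pos[OF assms, of \<theta>]
      by (subst (asm) integral_eq_0_iff[OF cont]) (auto simp: less_imp_le)
    then have "1 / ar2_gain r \<theta> 0 = 0" by (rule bspec) simp
    then show False using ar2_gain_pos[OF assms, of \<theta> 0] by simp
  qed
  ultimately show ?thesis by simp
qed

lemma continuous_on_ar2_density:
  assumes "0 < r" "r < 1"
  shows "continuous_on {-pi..pi} (ar2_density r \<theta>)"
proof -
  have "continuous_on {-pi..pi} (\<lambda>\<omega>. 1 / integral {-pi..pi} (\<lambda>\<omega>. 1 / ar2_gain r \<theta> \<omega>) / ar2_gain r \<theta> \<omega>)"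
    by (intro continuous_on_inverse_ar2_gain assms continuous_intros)
  then show ?thesis
    by (rule continuous_on_eq) (simp add: ar2_density_def)
qed

lemma ar2_density_in_F_AR2:
  assumes "0 < r" "r < 1"
  shows "ar2_density r \<theta> \<in> F_AR2"
proof -
  let ?I = "integral {-pi..pi} (\<lambda>\<omega>. 1 / ar2_gain r \<theta> \<omega>)"
  have I: "0 < ?I" by (rule integral_inverse_ar2_gain_pos[OF assms])
  have "integral {-pi..pi} (ar2_density r \<theta>) = integral {-pi..pi} (\<lambda>\<omega>. (1 / ?I) * (1 / ar2_gain r \<theta> \<omega>))"
    by (intro integral_cong) (simp add: ar2_density_def)
  also have "\<dots> = 1" using I by (subst integral_mult_right) simp
  finally have 1: "integral {-pi..pi} (ar2_density r \<theta>) = 1" .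
  have "ar2_density r \<theta> absolutely_integrable_on {-pi..pi}"
    by (intro absolutely_integrable_continuous_real continuous_on_ar2_density assms)
  moreover have "ar2_density r \<theta> \<omega> = (2 * pi / ?I) / (2 * pi) /
         (norm (1 - of_real (2 * r * cos \<theta>) * exp (- (\<i> * of_real \<omega>))
                  - of_real (- r\<^sup>2) * exp (- (2 * \<i> * of_real \<omega>)))) ^ 2" if "\<omega> \<in> {-pi..pi}" for \<omega>
    using that unfolding ar2_gain_def[symmetric] by (simp add: ar2_density_def)
  moreover have "0 < 2 * pi / ?I" using I by simp
  moreover have "\<forall>z :: complex. norm z \<le> 1 \<longrightarrow> 1 - of_real (2 * r * cos \<theta>) * z - of_real (- r\<^sup>2) * z ^ 2 \<noteq> 0"
    using ar2_polynomial_nonzero[OF assms] by blast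
  moreover have "ar2_density r \<theta> \<in> extensional {-pi..pi}" by (simp add: ar2_density_def)
  moreover have "0 \<le> ar2_density r \<theta> \<omega>" "ar2_density r \<theta> (- \<omega>) = ar2_density r \<theta> \<omega>" if "\<omega> \<in> {-pi..pi}" for \<omega>
    using that I ar2_gain_pos[OF assms, of \<theta> \<omega>]
    by (auto simp: ar2_density_def ar2_gain_eq)
  ultimately show ?thesis
    using 1 unfolding F_AR2_def F_all_def by blast
qed

text \<open>Away from the peaks at \<theta> and -\<theta> the gain is bounded below, so its inverse
  contributes a bounded amount there, while the normalizing integral grows at least like 1 / (1 -
  r). The test function is even and takes the same value at both peaks.\<close>

lemma ar2_density_concentrates:
  assumes \<theta>: "0 < \<theta>" "\<theta> < pi"
  shows "(\<lambda>m. integral {-pi..pi} (\<lambda>\<omega>. cos (h * \<omega>) * ar2_density (1 - 1 / (real m + 2)) \<theta> \<omega>)) \<longlonglongrightarrow> cos (h * \<theta>)"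
proof (rule LIMSEQ_I)
  fix e :: real assume e: "0 < e"
  \<comment> \<open>By evenness cos (h \<omega>) is a function of cos \<omega>. Continuity in that
    variable treats both peaks at once and measures distance in the quantity that occurs in the
    gain.\<close>
  have "continuous_on {-1..1} (\<lambda>x. cos (h * arccos x))"
    by (intro continuous_intros) auto
  moreover have "cos \<theta> \<in> {-1..1}" by simp
  ultimately obtain \<delta> where \<delta>: "0 < \<delta>" and
    \<delta>': "\<And>x. x \<in> {-1..1} \<Longrightarrow> dist x (cos \<theta>) < \<delta> \<Longrightarrow> dist (cos (h * arccos x)) (cos (h * arccos (cos \<theta>))) < e / 2"
    using e unfolding continuous_on_iff by (meson half_gt_zero)
  have near: "\<bar>cos (h * \<omega>) - cos (h * \<theta>)\<bar> \<le> e / 2"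
    if "\<omega> \<in> {-pi..pi}" "\<bar>cos \<omega> - cos \<theta>\<bar> < \<delta>" for \<omega>
  proof -
    have "arccos (cos \<omega>) = \<bar>\<omega>\<bar>"
      using that(1) arccos_cos[of "\<bar>\<omega>\<bar>"] by (simp add: abs_le_iff)
    moreover have "arccos (cos \<theta>) = \<theta>" using \<theta> by (simp add: arccos_cos)
    moreover have "cos (h * \<bar>\<omega>\<bar>) = cos (h * \<omega>)" by (cases "0 \<le> \<omega>") simp_all
    ultimately show ?thesis using \<delta>'[of "cos \<omega>"] that(2) by (simp add: dist_real_def)
  qed
  \<comment> \<open>The lower bound for the gain off the peaks: there its first squared term is at
    least (\<delta> - \<delta> / 2)^2.\<close>
  define M where "M = \<delta>\<^sup>2 / 4"
  have M: "0 < M" using \<delta> by (simp add: M_def)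
  \<comment> \<open>In this order: r is at least 1/2, the lower bound for the integral applies, the
    error (1 - r)^2 cos \<omega> stays below \<delta> / 2, and the off-peak part stays below e / 2,
    since 4 * 13 / 200 < 1/2.\<close>
  define d where "d = min (min (1/2) \<theta>) (min (\<delta> / 2) (e * M / (200 * pi)))"
  have d: "0 < d" using \<delta> \<theta> e M by (simp add: d_def)
  have main: "\<bar>integral {-pi..pi} (\<lambda>\<omega>. cos (h * \<omega>) * ar2_density r \<theta> \<omega>) - cos (h * \<theta>)\<bar> < e"
    if r: "1 - d \<le> r" "r < 1" for r
  proof -
    have r': "1/2 \<le> r" "1 - r \<le> \<theta>" "1 - r \<le> \<delta> / 2" "1 - r \<le> e * M / (200 * pi)"
      using r(1) unfolding d_def by linarith+
    have r0: "0 < r" using r' by linarith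
    let ?D = "ar2_gain r \<theta>"
    let ?I = "integral {-pi..pi} (\<lambda>\<omega>. 1 / ?D \<omega>)"
    have I: "0 < ?I" by (rule integral_inverse_ar2_gain_pos[OF r0 r(2)])
    have Ige: "1 / (13 * (1 - r)) \<le> ?I" by (rule integral_inverse_ar2_gain_ge[OF r0 r(2) r'(2) \<theta>(2)])
    have Dpos: "0 < ?D \<omega>" for \<omega> by (rule ar2_gain_pos[OF r0 r(2)])
    have far: "M \<le> ?D \<omega>" if "\<delta> \<le> \<bar>cos \<omega> - cos \<theta>\<bar>" for \<omega>
    proof -
      have "1 * \<delta> \<le> (2 * r) * \<bar>cos \<omega> - cos \<theta>\<bar>" using that r' \<delta> by (intro mult_mono) auto
      then have "\<delta> \<le> \<bar>2 * r * (cos \<omega> - cos \<theta>)\<bar>" using r0 by (simp add: abs_mult)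
      moreover have "\<bar>(1 - r)\<^sup>2 * cos \<omega>\<bar> \<le> (1 - r) * 1"
        unfolding abs_mult using r r0 by (intro mult_mono) (auto simp: power2_eq_square mult_left_le)
      moreover have "(1 + r\<^sup>2) * cos \<omega> - 2 * r * cos \<theta> = 2 * r * (cos \<omega> - cos \<theta>) + (1 - r)\<^sup>2 * cos \<omega>"
        by (simp add: power2_eq_square algebra_simps)
      moreover have "\<delta> / 2 \<le> \<bar>x + y\<bar>" if "\<delta> \<le> \<bar>x\<bar>" "\<bar>y\<bar> \<le> (1 - r) * 1" for x y
        using abs_triangle_ineq[of "x + y" "- y"] that r'(3) by simp
      ultimately have "\<delta> / 2 \<le> \<bar>(1 + r\<^sup>2) * cos \<omega> - 2 * r * cos \<theta>\<bar>"
        by metis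
      then have "(\<delta> / 2)\<^sup>2 \<le> \<bar>(1 + r\<^sup>2) * cos \<omega> - 2 * r * cos \<theta>\<bar>\<^sup>2" using \<delta> by (intro power_mono) auto
      then show ?thesis unfolding ar2_gain_eq M_def by (simp add: power_divide add_increasing2)
    qed
    have ptw: "\<bar>(cos (h * \<omega>) - cos (h * \<theta>)) / ?D \<omega>\<bar> \<le> (e / 2) * (1 / ?D \<omega>) + 2 / M" if "\<omega> \<in> {-pi..pi}" for \<omega>
    proof (cases "\<bar>cos \<omega> - cos \<theta>\<bar> < \<delta>")
      case True
      have "\<bar>(cos (h * \<omega>) - cos (h * \<theta>)) / ?D \<omega>\<bar> \<le> (e / 2) / ?D \<omega>"
        using divide_right_mono[OF near[OF that True], of "?D \<omega>"] Dpos[of \<omega>] by simp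
      then show ?thesis using M by (simp add: add_increasing2)
    next
      case False
      have "\<bar>cos (h * \<omega>) - cos (h * \<theta>)\<bar> \<le> 2"
        using abs_cos_le_one[of "h * \<omega>"] abs_cos_le_one[of "h * \<theta>"] by linarith
      then have "\<bar>(cos (h * \<omega>) - cos (h * \<theta>)) / ?D \<omega>\<bar> \<le> 2 / M"
        using far[of \<omega>] False M Dpos[of \<omega>] unfolding abs_divide by (intro frac_le) auto
      then show ?thesis using e Dpos[of \<omega>] by (simp add: add_increasing)
    qed
    have cont: "continuous_on {-pi..pi} (\<lambda>\<omega>. g \<omega> / ?D \<omega>)" if "continuous_on {-pi..pi} g" for g
      using that by (rule continuous_on_inverse_ar2_gain[OF r0 r(2)])
    have int: "(\<lambda>\<omega>. g \<omega> / ?D \<omega>) integrable_on {-pi..pi}" if "continuous_on {-pi..pi} g" for g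
      by (intro integrable_continuous_interval cont that)
    have ib: "(\<lambda>\<omega>. (e / 2) * (1 / ?D \<omega>)) integrable_on {-pi..pi}"
      by (intro integrable_continuous_interval continuous_on_mult continuous_on_const cont)
    have "norm (integral {-pi..pi} (\<lambda>\<omega>. (cos (h * \<omega>) - cos (h * \<theta>)) / ?D \<omega>)) \<le>
        integral {-pi..pi} (\<lambda>\<omega>. (e / 2) * (1 / ?D \<omega>) + 2 / M)"
    proof (rule integral_norm_bound_integral)
      show "(\<lambda>\<omega>. (cos (h * \<omega>) - cos (h * \<theta>)) / ?D \<omega>) integrable_on {-pi..pi}"
        by (intro int continuous_intros)
      show "(\<lambda>\<omega>. (e / 2) * (1 / ?D \<omega>) + 2 / M) integrable_on {-pi..pi}"
        by (intro integrable_add ib integrable_continuous_interval continuous_intros)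
    qed (use ptw in simp)
    also have "\<dots> = integral {-pi..pi} (\<lambda>\<omega>. (e / 2) * (1 / ?D \<omega>)) + integral {-pi..pi} (\<lambda>\<omega>. 2 / M)"
      by (intro Henstock_Kurzweil_Integration.integral_add ib integrable_continuous_interval continuous_intros)
    also have "\<dots> = (e / 2) * ?I + 4 * pi / M"
      by (simp only: Henstock_Kurzweil_Integration.integral_mult_right) simp
    finally have num: "\<bar>integral {-pi..pi} (\<lambda>\<omega>. (cos (h * \<omega>) - cos (h * \<theta>)) / ?D \<omega>)\<bar> \<le> (e / 2) * ?I + 4 * pi / M" by simp
    have "integral {-pi..pi} (\<lambda>\<omega>. cos (h * \<omega>) * ar2_density r \<theta> \<omega>) =
        integral {-pi..pi} (\<lambda>\<omega>. (1 / ?I) * (cos (h * \<omega>) / ?D \<omega>))"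
      by (intro integral_cong) (simp add: ar2_density_def)
    also have "\<dots> = integral {-pi..pi} (\<lambda>\<omega>. cos (h * \<omega>) / ?D \<omega>) / ?I"
      by (subst integral_mult_right) simp
    finally have "integral {-pi..pi} (\<lambda>\<omega>. cos (h * \<omega>) * ar2_density r \<theta> \<omega>) - cos (h * \<theta>) =
        (integral {-pi..pi} (\<lambda>\<omega>. cos (h * \<omega>) / ?D \<omega>) - cos (h * \<theta>) * ?I) / ?I"
      using I by (simp add: diff_divide_distrib)
    also have "integral {-pi..pi} (\<lambda>\<omega>. cos (h * \<omega>) / ?D \<omega>) - cos (h * \<theta>) * ?I =
        integral {-pi..pi} (\<lambda>\<omega>. (cos (h * \<omega>) - cos (h * \<theta>)) / ?D \<omega>)"
    proof -
      have "cos (h * \<theta>) * ?I = integral {-pi..pi} (\<lambda>\<omega>. cos (h * \<theta>) / ?D \<omega>)"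
        by (subst integral_mult_right[symmetric]) simp
      then show ?thesis
        by (simp add: diff_divide_distrib Henstock_Kurzweil_Integration.integral_diff int continuous_intros)
    qed
    finally have "\<bar>integral {-pi..pi} (\<lambda>\<omega>. cos (h * \<omega>) * ar2_density r \<theta> \<omega>) - cos (h * \<theta>)\<bar> \<le>
        ((e / 2) * ?I + 4 * pi / M) / ?I"
      using num I by (simp add: divide_right_mono)
    also have "\<dots> = e / 2 + (4 * pi / M) * (1 / ?I)"
      using I by (simp add: add_divide_distrib)
    finally have le: "\<bar>integral {-pi..pi} (\<lambda>\<omega>. cos (h * \<omega>) * ar2_density r \<theta> \<omega>) - cos (h * \<theta>)\<bar> \<le>
        e / 2 + (4 * pi / M) * (1 / ?I)" .
    have "1 / ?I \<le> 13 * (1 - r)"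
      using Ige I r by (simp add: field_simps)
    then have "(4 * pi / M) * (1 / ?I) \<le> (4 * pi / M) * (13 * (e * M / (200 * pi)))"
      using r'(4) M by (intro mult_left_mono) auto
    also have "\<dots> < e / 2" using M e by (simp add: field_simps)
    finally show ?thesis using le by linarith
  qed
  obtain m0 where m0: "1 / d < real m0" using reals_Archimedean2 by blast
  have "1 / (real m + 2) \<le> d" if "m0 \<le> m" for m
  proof -
    have "1 / d \<le> real m + 2" using m0 that by linarith
    then show ?thesis using d by (simp add: field_simps)
  qed
  then show "\<exists>no. \<forall>m\<ge>no. norm (integral {-pi..pi} (\<lambda>\<omega>. cos (h * \<omega>) * ar2_density (1 - 1 / (real m + 2)) \<theta> \<omega>) - cos (h * \<theta>)) < e"
    by (intro exI[of _ m0] allI impI) (simp add: main)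
qed

section \<open>Covariance matrices of mixtures with white noise\<close>

lemma Sigma_mat_nth:
  assumes "continuous_on {-pi..pi} f"
  shows "(Sigma_mat f :: real ^ ('n::{finite,linorder}) ^ ('n::{finite,linorder})) $ j $ l =
    integral {-pi..pi} (\<lambda>\<omega>. cos ((real (pos j) - real (pos l)) * \<omega>) * f \<omega>)"
proof -
  let ?g = "\<lambda>\<omega>. exp (- (\<i> * of_real ((real (pos j) - real (pos l)) * \<omega>))) * complex_of_real (f \<omega>)"
  have "?g integrable_on {-pi..pi}"
    by (intro integrable_continuous_interval continuous_intros assms)
  then have "Re (integral {-pi..pi} ?g) = integral {-pi..pi} (Re \<circ> ?g)"
    by (rule integral_linear[OF _ bounded_linear_Re, symmetric])
  also have "Re \<circ> ?g = (\<lambda>\<omega>. cos ((real (pos j) - real (pos l)) * \<omega>) * f \<omega>)"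
    by (simp add: fun_eq_iff Re_exp)
  finally show ?thesis by (simp add: Sigma_mat_def)
qed

lemma inj_pos: "inj (pos :: 'n::{finite,linorder} \<Rightarrow> nat)"
proof (rule linorder_injI)
  fix x y :: 'n assume "x < y"
  then have "{i. i \<le> x} \<subset> {i. i \<le> y}" by (auto simp: psubset_eq set_eq_iff intro!: exI[of _ y])
  then show "pos x \<noteq> pos y" unfolding pos_def by (metis finite psubset_card_mono less_irrefl)
qed

lemma integral_cos_full_period:
  "integral {-pi..pi} (\<lambda>\<omega>. cos ((real a - real b) * \<omega>)) = (if a = b then 2 * pi else 0)"
proof (cases "a = b")
  case False
  define h where "h = real a - real b"
  have h: "h \<noteq> 0" using False by (simp add: h_def)
  have "((\<lambda>\<omega>. cos (h * \<omega>)) has_integral sin (h * pi) / h - sin (h * - pi) / h) {-pi..pi}"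
    using h by (intro fundamental_theorem_of_calculus)
      (auto intro!: derivative_eq_intros simp flip: has_real_derivative_iff_has_vector_derivative)
  moreover have "h * pi = of_int (int a - int b) * pi" by (simp add: h_def)
  then have "sin (h * pi) = 0" by (simp only: sin_npi_int mult.commute[of _ pi])
  ultimately show ?thesis using False by (simp add: h_def integral_unique)
qed simp

text \<open>The constant density 1 / (2 \<pi>) contributes the identity matrix, because the cosines
  of nonzero integer frequency integrate to zero over a full period.\<close>

lemma Sigma_mat_mixture:
  assumes "continuous_on {-pi..pi} f"
  shows "(Sigma_mat (\<lambda>\<omega>\<in>{-pi..pi}. c1 * f \<omega> + c2 / (2 * pi)) :: real ^ ('n::{finite,linorder}) ^ ('n::{finite,linorder})) =
    c1 *\<^sub>R Sigma_mat f + c2 *\<^sub>R mat 1"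
proof -
  let ?f = "\<lambda>\<omega>\<in>{-pi..pi}. c1 * f \<omega> + c2 / (2 * pi)"
  have cont: "continuous_on {-pi..pi} ?f"
    by (rule continuous_on_eq[of _ "\<lambda>\<omega>. c1 * f \<omega> + c2 / (2 * pi)"]) (auto intro!: continuous_intros assms)
  have "(Sigma_mat ?f :: real ^ ('n::{finite,linorder}) ^ ('n::{finite,linorder})) $ j $ l = (c1 *\<^sub>R Sigma_mat f + c2 *\<^sub>R mat 1) $ j $ l" for j l
  proof -
    let ?c = "\<lambda>\<omega>. cos ((real (pos j) - real (pos l)) * \<omega>)"
    have "(Sigma_mat ?f :: real ^ ('n::{finite,linorder}) ^ ('n::{finite,linorder})) $ j $ l =
        integral {-pi..pi} (\<lambda>\<omega>. c1 * (?c \<omega> * f \<omega>) + c2 / (2 * pi) * ?c \<omega>)"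
      unfolding Sigma_mat_nth[OF cont] by (intro integral_cong) (simp add: algebra_simps)
    also have "\<dots> = c1 * integral {-pi..pi} (\<lambda>\<omega>. ?c \<omega> * f \<omega>) + c2 / (2 * pi) * integral {-pi..pi} ?c"
      by (subst Henstock_Kurzweil_Integration.integral_add)
         (auto intro!: integrable_continuous_interval continuous_intros assms
           simp only: Henstock_Kurzweil_Integration.integral_mult_right)
    finally show ?thesis
      by (simp add: Sigma_mat_nth[OF assms] integral_cos_full_period mat_def inj_eq[OF inj_pos])
  qed
  then show ?thesis by (simp add: vec_eq_iff)
qed

text \<open>The form is the integral of |sum_j v_j e^(i j \<omega>)|^2 f(\<omega>);
  \<open>sq\<close> is this identity in real terms.\<close>

lemma Sigma_mat_nonneg:
  fixes v :: "real ^ ('n::{finite,linorder})"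
  assumes "continuous_on {-pi..pi} f" and "\<And>\<omega>. \<omega> \<in> {-pi..pi} \<Longrightarrow> 0 \<le> f \<omega>"
  shows "0 \<le> v \<bullet> (Sigma_mat f *v v)"
proof -
  let ?c = "\<lambda>j l \<omega>. cos ((real (pos j) - real (pos l)) * \<omega>)"
  have sq: "(\<Sum>j\<in>UNIV. \<Sum>l\<in>UNIV. v $ j * v $ l * (?c j l \<omega> * f \<omega>)) =
      ((\<Sum>j\<in>UNIV. v $ j * cos (real (pos j) * \<omega>))\<^sup>2 + (\<Sum>j\<in>UNIV. v $ j * sin (real (pos j) * \<omega>))\<^sup>2) * f \<omega>" for \<omega>
  proof -
    have "(\<Sum>j\<in>UNIV. v $ j * cos (real (pos j) * \<omega>))\<^sup>2 + (\<Sum>j\<in>UNIV. v $ j * sin (real (pos j) * \<omega>))\<^sup>2 =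
        (\<Sum>j\<in>UNIV. \<Sum>l\<in>UNIV. v $ j * v $ l * ?c j l \<omega>)"
      unfolding power2_eq_square sum_product sum.distrib[symmetric]
      by (intro sum.cong refl, simp only: left_diff_distrib cos_diff) (simp add: distrib_left mult_ac)
    then show ?thesis by (simp add: sum_distrib_right mult.assoc)
  qed
  have "v \<bullet> (Sigma_mat f *v v) = (\<Sum>j\<in>UNIV. \<Sum>l\<in>UNIV. v $ j * v $ l * integral {-pi..pi} (\<lambda>\<omega>. ?c j l \<omega> * f \<omega>))"
    by (simp add: inner_vec_def matrix_vector_mult_def Sigma_mat_nth[OF assms(1)] sum_distrib_left mult_ac)
  also have "\<dots> = integral {-pi..pi} (\<lambda>\<omega>. \<Sum>j\<in>UNIV. \<Sum>l\<in>UNIV. v $ j * v $ l * (?c j l \<omega> * f \<omega>))"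
    by (subst integral_sum, (auto intro!: integrable_continuous_interval continuous_intros assms)[2],
        intro sum.cong refl, subst integral_sum)
       (auto intro!: integrable_continuous_interval continuous_intros assms)
  also have "\<dots> \<ge> 0"
    unfolding sq using assms(2)
    by (intro integral_nonneg integrable_continuous_interval continuous_intros assms(1)) auto
  finally show ?thesis .
qed

lemma transpose_Sigma_mat:
  fixes f :: "real \<Rightarrow> real"
  assumes "continuous_on {-pi..pi} f"
  shows "transpose (Sigma_mat f :: real ^ ('n::{finite,linorder}) ^ ('n::{finite,linorder})) = Sigma_mat f"
proof -
  have "cos ((real (pos l) - real (pos j)) * \<omega>) = cos ((real (pos j) - real (pos l)) * \<omega>)" for \<omega> and j l :: 'n
    by (metis cos_minus minus_diff_eq mult_minus_left)
  then show ?thesis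
    by (simp add: vec_eq_iff transpose_def Sigma_mat_nth[OF assms])
qed

lemma E_mat_0_outer:
  "(E_mat 0 \<theta> ** transpose (E_mat 0 \<theta>)) $ j $ l = cos ((real (pos j) - real (pos l)) * \<theta>)"
  by (simp add: E_mat_def matrix_matrix_mult_def transpose_def sum_2 left_diff_distrib cos_diff)

text \<open>The autoregressive parts are only known to have nonnegative definite covariances; the
  white noise makes the mixtures positive definite, as continuity of the Gaussian law requires.
  Entrywise the limit is cos ((j - l) \<theta>), which the addition formula recognizes as an outer
  product.\<close>

lemma F_AR2_ext_approximation:
  assumes \<theta>: "0 < \<theta>" "\<theta> < pi" and c: "0 < c1" "0 < c2" "c1 + c2 = 1"
  obtains f where "\<And>m :: nat. f m \<in> F_AR2_ext"
    and "\<And>m. pos_definite (Sigma_mat (f m) :: real ^ ('n::{finite,linorder}) ^ ('n::{finite,linorder}))"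
    and "(\<lambda>m. Sigma_mat (f m) :: real ^ ('n::{finite,linorder}) ^ ('n::{finite,linorder})) \<longlonglongrightarrow>
      c1 *\<^sub>R (E_mat 0 \<theta> ** transpose (E_mat 0 \<theta>)) + c2 *\<^sub>R mat 1"
proof -
  define g where "g m = ar2_density (1 - 1 / (real m + 2)) \<theta>" for m :: nat
  have r: "0 < 1 - 1 / (real m + 2)" "1 - 1 / (real m + 2) < 1" for m :: nat by (simp_all add: field_simps)
  have gF: "g m \<in> F_AR2" for m unfolding g_def by (rule ar2_density_in_F_AR2[OF r])
  have gc: "continuous_on {-pi..pi} (g m)" for m unfolding g_def by (rule continuous_on_ar2_density[OF r])
  have g0: "0 \<le> g m \<omega>" if "\<omega> \<in> {-pi..pi}" for m \<omega> using gF[of m] that by (auto simp: F_AR2_def F_all_def)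
  define f where "f m = (\<lambda>\<omega>\<in>{-pi..pi}. c1 * g m \<omega> + c2 / (2 * pi))" for m
  have S: "(Sigma_mat (f m) :: real ^ ('n::{finite,linorder}) ^ ('n::{finite,linorder})) = c1 *\<^sub>R Sigma_mat (g m) + c2 *\<^sub>R mat 1" for m
    unfolding f_def by (rule Sigma_mat_mixture[OF gc])
  show thesis
  proof (rule that)
    show "f m \<in> F_AR2_ext" for m
      unfolding F_AR2_ext_def f_def using gF[of m] c by (intro CollectI exI[of _ c1] exI[of _ c2] exI[of _ "g m"]) simp
    show "pos_definite (Sigma_mat (f m) :: real ^ ('n::{finite,linorder}) ^ ('n::{finite,linorder}))" for m
      unfolding pos_definite_def
    proof (intro conjI allI impI)
      have "transpose (c1 *\<^sub>R Sigma_mat (g m) + c2 *\<^sub>R mat 1 :: real ^ ('n::{finite,linorder}) ^ ('n::{finite,linorder})) =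
          c1 *\<^sub>R transpose (Sigma_mat (g m)) + c2 *\<^sub>R mat 1"
        by (simp add: vec_eq_iff transpose_def mat_def)
      then show "transpose (Sigma_mat (f m) :: real ^ ('n::{finite,linorder}) ^ ('n::{finite,linorder})) = Sigma_mat (f m)"
        unfolding S by (simp add: transpose_Sigma_mat[OF gc])
      fix v :: "real ^ ('n::{finite,linorder})" assume "v \<noteq> 0"
      moreover have "0 \<le> v \<bullet> (Sigma_mat (g m) *v v)" by (rule Sigma_mat_nonneg[OF gc g0])
      ultimately show "0 < v \<bullet> (Sigma_mat (f m) *v v)"
        unfolding S using c
        by (simp add: matrix_vector_mult_add_rdistrib matrix_scaleR_vector inner_add_right add_nonneg_pos)
    qed
    have "(\<lambda>m. (Sigma_mat (g m) :: real ^ ('n::{finite,linorder}) ^ ('n::{finite,linorder}))) \<longlonglongrightarrow> E_mat 0 \<theta> ** transpose (E_mat 0 \<theta>)"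
      by (intro vec_tendstoI)
         (simp add: Sigma_mat_nth[OF gc] E_mat_0_outer, simp add: g_def ar2_density_concentrates[OF \<theta>])
    then show "(\<lambda>m. Sigma_mat (f m) :: real ^ ('n::{finite,linorder}) ^ ('n::{finite,linorder})) \<longlonglongrightarrow>
        c1 *\<^sub>R (E_mat 0 \<theta> ** transpose (E_mat 0 \<theta>)) + c2 *\<^sub>R mat 1"
      unfolding S by (intro tendsto_intros)
  qed
qed

subsection \<open>The trigonometric regressors\<close>

text \<open>The orientation is such that adding \<phi> to the phase of every row of
  \<open>E_mat\<close> is the same as applying \<open>rotation \<phi>\<close> to its
  argument.\<close>

definition rotation :: "real \<Rightarrow> real ^ 2 ^ 2" where
  "rotation \<phi> = vector [vector [cos \<phi>, sin \<phi>], vector [- sin \<phi>, cos \<phi>]]"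

lemma rotation_mult_vector:
  "(rotation \<phi> *v x) $ 1 = cos \<phi> * x $ 1 + sin \<phi> * x $ 2"
  "(rotation \<phi> *v x) $ 2 = - sin \<phi> * x $ 1 + cos \<phi> * x $ 2"
  by (simp_all add: rotation_def matrix_vector_mult_def sum_2)

lemma orthogonal_matrix_rotation: "orthogonal_matrix (rotation \<phi>)"
  unfolding orthogonal_matrix
  by (simp add: vec_eq_iff forall_2 rotation_def matrix_matrix_mult_def transpose_def sum_2 mat_def
      power2_eq_square[symmetric] mult.commute)

lemma E_mat_mult_vector_nth:
  "(E_mat s \<omega> *v x) $ j = real (pos j) ^ s * (cos (real (pos j) * \<omega>) * x $ 1 + sin (real (pos j) * \<omega>) * x $ 2)"
  by (simp add: E_mat_def matrix_vector_mult_def sum_2 algebra_simps)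

text \<open>The \<open>s\<close>-th derivative of \<open>E\<^sub>0(\<omega>) x\<close> is \<open>E\<^sub>s(\<omega>) x\<close> with \<open>x\<close> rotated by \<open>s \<pi> / 2\<close>.\<close>
lemma E_mat_Taylor:
  fixes j :: "'n::{finite,linorder}"
  shows "\<exists>t. \<bar>t\<bar> \<le> \<bar>\<eta>\<bar> \<and>
    (E_mat 0 (\<gamma> + \<eta>) *v x) $ j =
      (\<Sum>s<p. (\<eta> ^ s / fact s) * (E_mat s \<gamma> *v (rotation (real s * pi / 2) *v x)) $ j) +
      (\<eta> ^ p / fact p) * (E_mat p (\<gamma> + t) *v (rotation (real p * pi / 2) *v x)) $ j"
proof -
  let ?d = "\<lambda>s \<eta>. (E_mat s (\<gamma> + \<eta>) *v (rotation (real s * pi / 2) *v x)) $ j"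
  have d: "?d s \<eta> = real (pos j) ^ s *
      (cos (real (pos j) * (\<gamma> + \<eta>) + real s * pi / 2) * x $ 1 + sin (real (pos j) * (\<gamma> + \<eta>) + real s * pi / 2) * x $ 2)" for s \<eta>
    by (simp add: E_mat_mult_vector_nth rotation_mult_vector cos_add sin_add algebra_simps)
  have shift: "cos (a + real (Suc s) * pi / 2) = - sin (a + real s * pi / 2)"
    "sin (a + real (Suc s) * pi / 2) = cos (a + real s * pi / 2)" for a s
  proof -
    have "a + real (Suc s) * pi / 2 = (a + real s * pi / 2) + pi / 2" by (simp add: field_simps)
    then show "cos (a + real (Suc s) * pi / 2) = - sin (a + real s * pi / 2)"
      "sin (a + real (Suc s) * pi / 2) = cos (a + real s * pi / 2)"
      by (simp_all only: cos_add sin_add) simp_all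
  qed
  have "DERIV (?d s) \<eta> :> ?d (Suc s) \<eta>" for s \<eta>
    unfolding d shift by (auto intro!: derivative_eq_intros simp: algebra_simps)
  then obtain t where "\<bar>t\<bar> \<le> \<bar>\<eta>\<bar>" "?d 0 \<eta> = (\<Sum>s<p. ?d s 0 / fact s * \<eta> ^ s) + ?d p t / fact p * \<eta> ^ p"
    using Maclaurin_all_le[of ?d "?d 0" \<eta> p] by blast
  moreover have "?d 0 \<eta> = (E_mat 0 (\<gamma> + \<eta>) *v x) $ j"
    by (simp add: E_mat_mult_vector_nth rotation_mult_vector)
  ultimately show ?thesis by (intro exI[of _ t]) (simp add: mult_ac)
qed

text \<open>Vandermonde: if \<open>c\<close> is orthogonal to all regressors then \<open>\<Sum>\<^sub>j c\<^sub>j a\<^sub>j q(j) = 0\<close> for every polynomial \<open>q\<close>.\<close>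
lemma E_mat_spans:
  fixes c :: "real ^ ('n::{finite,linorder})"
  assumes "\<And>s x. c \<bullet> (E_mat s \<gamma> *v x) = 0"
  shows "c = 0"
proof -
  have inj: "pos i = pos j \<longleftrightarrow> i = j" for i j :: 'n by (rule inj_eq[OF inj_pos])
  have "c $ j0 = 0" for j0
  proof -
    \<comment> \<open>The phase vector of row j0, which gives a j0 = cos^2 + sin^2 = 1 whatever
      \<gamma> is.\<close>
    define x :: "real ^ 2" where "x = vector [cos (real (pos j0) * \<gamma>), sin (real (pos j0) * \<gamma>)]"
    define a where "a j = cos (real (pos j) * \<gamma>) * x $ 1 + sin (real (pos j) * \<gamma>) * x $ 2" for j :: 'n
    have pow: "(\<Sum>j\<in>UNIV. c $ j * a j * real (pos j) ^ s) = 0" for s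
      using assms[of s x] by (simp add: inner_vec_def E_mat_mult_vector_nth a_def mult_ac)
    have poly: "(\<Sum>j\<in>UNIV. c $ j * a j * poly q (real (pos j))) = 0" for q :: "real poly"
    proof -
      have "(\<Sum>j\<in>UNIV. c $ j * a j * poly q (real (pos j))) =
          (\<Sum>j\<in>UNIV. \<Sum>s\<le>degree q. coeff q s * (c $ j * a j * real (pos j) ^ s))"
        by (simp add: poly_altdef sum_distrib_left mult_ac)
      also have "\<dots> = (\<Sum>s\<le>degree q. coeff q s * (\<Sum>j\<in>UNIV. c $ j * a j * real (pos j) ^ s))"
        by (subst sum.swap) (simp add: sum_distrib_left)
      finally show ?thesis by (simp add: pow)
    qed
    \<comment> \<open>An unnormalized Lagrange polynomial: it vanishes at every position except that
      of j0, where injectivity of \<open>pos\<close> keeps it nonzero.\<close>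
    define q :: "real poly" where "q = (\<Prod>i\<in>UNIV - {j0}. [:- real (pos i), 1:])"
    have q: "poly q (real (pos j)) = (\<Prod>i\<in>UNIV - {j0}. real (pos j) - real (pos i))" for j
      by (simp add: q_def poly_prod)
    have "poly q (real (pos j)) = 0" if "j \<noteq> j0" for j
      unfolding q using that by (subst prod_zero_iff) auto
    then have "(\<Sum>j\<in>UNIV. c $ j * a j * poly q (real (pos j))) =
        (\<Sum>j\<in>UNIV. if j = j0 then c $ j0 * a j0 * poly q (real (pos j0)) else 0)"
      by (intro sum.cong) auto
    then have "c $ j0 * a j0 * poly q (real (pos j0)) = 0" by (simp add: poly)
    moreover have "poly q (real (pos j0)) \<noteq> 0" unfolding q by (subst prod_zero_iff) (auto simp: inj)
    moreover have "a j0 = 1" by (simp add: a_def x_def power2_eq_square[symmetric])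
    ultimately show ?thesis by simp
  qed
  then show ?thesis by (simp add: vec_eq_iff)
qed

text \<open>The \<open>LEAST\<close> in \<open>rho\<close> is attained: otherwise a nonzero vector
  orthogonal to the proper subspace L would be orthogonal to all regressors, against
  \<open>E_mat_spans\<close>.\<close>

lemma rho_properties:
  fixes L :: "(real ^ ('n::{finite,linorder})) set"
  assumes "subspace L" and "L \<noteq> UNIV"
  shows "\<not> span (columns (E_mat (rho \<gamma> L) \<gamma> :: real ^ 2 ^ ('n::{finite,linorder}))) \<subseteq> L"
    and "s < rho \<gamma> L \<Longrightarrow> E_mat s \<gamma> *v x \<in> L"
proof -
  have "\<exists>s. \<not> span (columns (E_mat s \<gamma> :: real ^ 2 ^ ('n::{finite,linorder}))) \<subseteq> L"
  proof (rule ccontr)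
    assume "\<not> ?thesis"
    then have in_L: "E_mat s \<gamma> *v x \<in> L" for s x
      using matrix_vector_mult_in_columnspace[of "E_mat s \<gamma> :: real ^ 2 ^ ('n::{finite,linorder})" x] by blast
    have "dim L < DIM(real ^ ('n::{finite,linorder}))"
      using assms dim_eq_full[of L] dim_subset_UNIV[of L] by (metis le_neq_implies_less span_eq_iff)
    then obtain c where "c \<noteq> 0" and orth: "\<And>y. y \<in> span L \<Longrightarrow> orthogonal c y"
    proof (rule orthogonal_to_subspace_exists)
      fix c assume "c \<noteq> 0" "\<And>y. y \<in> span L \<Longrightarrow> orthogonal c y"
      then show thesis by (rule that)
    qed
    moreover have "c = 0"
    proof (rule E_mat_spans)
      show "c \<bullet> (E_mat s \<gamma> *v x) = 0" for s x
        using orth[OF span_base[OF in_L]] by (simp add: orthogonal_def)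
    qed
    ultimately show False by simp
  qed
  then show "\<not> span (columns (E_mat (rho \<gamma> L) \<gamma> :: real ^ 2 ^ ('n::{finite,linorder}))) \<subseteq> L"
    unfolding rho_def by (rule LeastI_ex)
  assume "s < rho \<gamma> L"
  then have "span (columns (E_mat s \<gamma> :: real ^ 2 ^ ('n::{finite,linorder}))) \<subseteq> L"
    unfolding rho_def using not_less_Least by blast
  then show "E_mat s \<gamma> *v x \<in> L"
    using matrix_vector_mult_in_columnspace[of "E_mat s \<gamma> :: real ^ 2 ^ ('n::{finite,linorder})" x] by blast
qed

lemma AE_std_gaussian_lebesgue:
  assumes "AE z in lebesgue. P z"
  shows "AE z in (std_gaussian :: (real ^ 'm) measure). P z"
proof -
  have "AE z in lborel. P z" using assms by (simp add: AE_completion_iff)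
  then show ?thesis unfolding std_gaussian_def by (subst AE_density) auto
qed

lemma AE_std_gaussian_not_in_subspace:
  fixes S :: "(real ^ 'm) set"
  assumes "subspace S" and "S \<noteq> UNIV"
  shows "AE z in std_gaussian. z \<notin> S"
proof -
  have "dim S < DIM(real ^ 'm)"
    using assms dim_eq_full[of S] dim_subset_UNIV[of S] by (metis le_neq_implies_less span_eq_iff)
  then have "S \<in> null_sets lebesgue" using negligible_lowdim negligible_iff_null_sets by blast
  then show ?thesis by (intro AE_std_gaussian_lebesgue AE_not_in)
qed

subsection \<open>Equivariance of the test statistic\<close>

locale equivariant_estimators =
  fixes X :: "real ^ 'k ^ 'n"
    and \<beta>c :: "real ^ 'n \<Rightarrow> real ^ 'k"
    and \<Omega>c :: "real ^ 'n \<Rightarrow> real ^ 'q ^ 'q"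
    and N :: "(real ^ 'n) set"
  assumes estimators: "estimator_conditions X \<beta>c \<Omega>c N"
begin

abbreviation Ns :: "(real ^ 'n) set" where
  "Ns \<equiv> N_star \<Omega>c N"

text \<open>Replacing the inverse by 0 on the exceptional set reproduces the default value 0 of both
  \<open>T_stat\<close> and \<open>xi_bar\<close>, so that one function serves for both.\<close>

definition quad :: "real ^ 'q \<Rightarrow> real ^ 'n \<Rightarrow> real" where
  "quad w y = w \<bullet> ((if y \<notin> Ns then matrix_inv (\<Omega>c y) else 0) *v w)"

lemma quad_scaleR: "quad (c *\<^sub>R w) y = c\<^sup>2 * quad w y"
  by (simp add: quad_def matrix_vector_mult_scaleR power2_eq_square)

lemma T_stat_eq_quad: "T_stat R r \<beta>c \<Omega>c N y = quad (R *v \<beta>c y - r) y"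
  by (simp add: T_stat_def quad_def)

lemma xi_bar_eq_quad: "xi_bar X R \<Omega>c N E x y = quad (R *v beta_hat X (E *v x)) y"
  by (simp add: xi_bar_def quad_def)

lemma not_in_Ns_iff: "y \<notin> Ns \<longleftrightarrow> y \<notin> N \<and> invertible (\<Omega>c y)"
  by (auto simp: N_star_def invertible_det_nz)

lemma equivariant:
  assumes "y \<notin> N" and "\<delta> \<noteq> 0"
  shows "\<delta> *\<^sub>R y + X *v \<eta> \<notin> N"
    and "\<beta>c (\<delta> *\<^sub>R y + X *v \<eta>) = \<delta> *\<^sub>R \<beta>c y + \<eta>"
    and "\<Omega>c (\<delta> *\<^sub>R y + X *v \<eta>) = \<delta>\<^sup>2 *\<^sub>R \<Omega>c y"
  using estimators assms unfolding estimator_conditions_def by blast+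

lemma matrix_inv_scaled:
  assumes "y \<notin> Ns" and "\<delta> \<noteq> 0"
  shows "\<delta> *\<^sub>R y + X *v \<eta> \<notin> Ns"
    and "matrix_inv (\<Omega>c (\<delta> *\<^sub>R y + X *v \<eta>)) = (1 / \<delta>\<^sup>2) *\<^sub>R matrix_inv (\<Omega>c y)"
proof -
  have y: "y \<notin> N" "invertible (\<Omega>c y)" using assms(1) by (auto simp: not_in_Ns_iff)
  have "\<Omega>c (\<delta> *\<^sub>R y + X *v \<eta>) ** ((1 / \<delta>\<^sup>2) *\<^sub>R matrix_inv (\<Omega>c y)) = mat 1"
    using assms(2) by (simp add: equivariant[OF y(1) assms(2)] matrix_mult_scaleR invertible_matrix_inv[OF y(2)])
  moreover from this have "invertible (\<Omega>c (\<delta> *\<^sub>R y + X *v \<eta>))"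
    by (metis invertible_right_inverse)
  ultimately show "\<delta> *\<^sub>R y + X *v \<eta> \<notin> Ns"
      "matrix_inv (\<Omega>c (\<delta> *\<^sub>R y + X *v \<eta>)) = (1 / \<delta>\<^sup>2) *\<^sub>R matrix_inv (\<Omega>c y)"
    using equivariant(1)[OF y(1) assms(2)] matrix_inv_unique by (auto simp: not_in_Ns_iff)
qed

lemma in_Ns_iff:
  assumes "\<delta> \<noteq> 0"
  shows "\<delta> *\<^sub>R y + X *v \<eta> \<in> Ns \<longleftrightarrow> y \<in> Ns"
proof -
  \<comment> \<open>The affine map is undone by one of the same form, so that the one-sided
    \<open>matrix_inv_scaled\<close> gives both directions.\<close>
  have "(1 / \<delta>) *\<^sub>R (\<delta> *\<^sub>R y + X *v \<eta>) + X *v ((- 1 / \<delta>) *\<^sub>R \<eta>) = y"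
    using assms by (simp only: matrix_vector_mult_scaleR) (simp add: scaleR_add_right)
  then show ?thesis
    using matrix_inv_scaled(1)[OF _ assms, of y \<eta>]
      matrix_inv_scaled(1)[of "\<delta> *\<^sub>R y + X *v \<eta>" "1 / \<delta>" "(- 1 / \<delta>) *\<^sub>R \<eta>"] assms by auto
qed

text \<open>Used with \<delta> tending to 0: the vector tends to R \<eta> - r, while the factor 1 /
  \<delta>^2 outgrows every critical value.\<close>

lemma T_stat_affine:
  assumes "y \<notin> Ns" and "\<delta> \<noteq> 0"
  shows "T_stat R r \<beta>c \<Omega>c N (\<delta> *\<^sub>R y + X *v \<eta>) = quad (R *v (\<delta> *\<^sub>R \<beta>c y + \<eta>) - r) y / \<delta>\<^sup>2"
proof -
  have "y \<notin> N" using assms(1) by (simp add: not_in_Ns_iff)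
  then show ?thesis
    using assms by (simp add: T_stat_eq_quad quad_def matrix_inv_scaled equivariant(2) matrix_scaleR_vector)
qed

lemma T_stat_null_shift:
  assumes "R *v \<beta> = r"
  shows "T_stat R r \<beta>c \<Omega>c N (X *v \<beta> + u) = T_stat R 0 \<beta>c \<Omega>c N u"
proof (cases "u \<in> Ns")
  case True
  then have "X *v \<beta> + u \<in> Ns" using in_Ns_iff[of 1 u \<beta>] by (simp add: add.commute)
  then show ?thesis using True by (simp add: T_stat_def)
next
  case False
  then show ?thesis
    using T_stat_affine[of u 1 R r \<beta>] T_stat_affine[of u 1 R 0 0] assms
    by (simp add: add.commute matrix_vector_right_distrib)
qed

lemma T_stat_invariant:
  assumes "l \<in> M0_lin X R" and "\<delta> \<noteq> 0"
  shows "T_stat R 0 \<beta>c \<Omega>c N (\<delta> *\<^sub>R u + l) = T_stat R 0 \<beta>c \<Omega>c N u"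
proof -
  obtain \<eta> where l: "l = X *v \<eta>" "R *v \<eta> = 0" using assms(1) by (auto simp: M0_def)
  show ?thesis
  proof (cases "u \<in> Ns")
    case True
    then have "\<delta> *\<^sub>R u + l \<in> Ns" using in_Ns_iff[OF assms(2)] l by simp
    then show ?thesis using True by (simp add: T_stat_def)
  next
    case False
    then show ?thesis
      using T_stat_affine[OF False assms(2), of R 0 \<eta>] assms(2) l
      by (simp add: T_stat_eq_quad matrix_vector_right_distrib matrix_vector_mult_scaleR quad_scaleR)
  qed
qed

lemma continuous_on_estimators:
  "continuous_on (- Ns) \<beta>c" "continuous_on (- Ns) (\<lambda>y. matrix_inv (\<Omega>c y))"
proof -
  have "continuous_on (- N) \<beta>c" "continuous_on (- N) \<Omega>c"
    using estimators by (auto simp: estimator_conditions_def)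
  moreover have "- Ns \<subseteq> - N" by (auto simp: N_star_def)
  ultimately have *: "continuous_on (- Ns) \<beta>c" "continuous_on (- Ns) \<Omega>c"
    by (auto intro: continuous_on_subset)
  then show "continuous_on (- Ns) \<beta>c" by simp
  show "continuous_on (- Ns) (\<lambda>y. matrix_inv (\<Omega>c y))"
    using * by (auto simp: continuous_on_def not_in_Ns_iff invertible_det_nz intro!: tendsto_matrix_inv)
qed

lemma closed_Ns: "closed Ns"
proof -
  have N: "closed N" "continuous_on (- N) \<Omega>c"
    using estimators by (auto simp: estimator_conditions_def)
  then have "continuous_on (- N) (\<lambda>y. det (\<Omega>c y))"
    by (auto simp: continuous_on_def intro!: tendsto_det)
  then have "open (- N \<inter> (\<lambda>y. det (\<Omega>c y)) -` (- {0}))"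
    using N by (intro continuous_open_preimage) auto
  moreover have "- N \<inter> (\<lambda>y. det (\<Omega>c y)) -` (- {0}) = - Ns"
    by (auto simp: N_star_def)
  ultimately show ?thesis by (simp add: closed_def)
qed

lemma sets_Ns [measurable, simp]: "Ns \<in> sets borel"
  by (simp add: closed_Ns)

lemma AE_not_in_Ns: "AE z in std_gaussian. z \<notin> Ns"
proof (rule AE_std_gaussian_lebesgue)
  have "N \<in> null_sets lebesgue" "AE y in lebesgue. y \<notin> N \<longrightarrow> det (\<Omega>c y) \<noteq> 0"
    using estimators by (auto simp: estimator_conditions_def)
  moreover from this(1) have "AE y in lebesgue. y \<notin> N" by (rule AE_not_in)
  ultimately show "AE y in lebesgue. y \<notin> Ns"
    by (auto simp: N_star_def)
qed

text \<open>Joint measurability is required since K averages over the vector and the sample point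
  independently. The exceptional set is closed, and off it the inverse is continuous.\<close>

lemma measurable_quad [measurable]:
  assumes [measurable]: "f \<in> borel_measurable M" "g \<in> borel_measurable M"
  shows "(\<lambda>x. quad (f x) (g x)) \<in> borel_measurable M"
proof -
  have [measurable]: "(\<lambda>y. if y \<in> Ns then 0 else matrix_inv (\<Omega>c y)) \<in> borel_measurable borel"
    by (intro borel_measurable_continuous_on_if sets_Ns continuous_on_const continuous_on_estimators)
  let ?O = "\<lambda>y. if y \<in> Ns then 0 else matrix_inv (\<Omega>c y)"
  have cont: "continuous_on UNIV (\<lambda>x :: (real ^ 'q ^ 'q) \<times> (real ^ 'q). snd x \<bullet> (fst x *v snd x))"
    unfolding continuous_on_def
    by (intro ballI tendsto_inner tendsto_matrix_vector_mult tendsto_fst tendsto_snd tendsto_ident_at)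
  have [measurable]: "(\<lambda>x. ?O (g x)) \<in> borel_measurable M" by measurable
  have "(\<lambda>x. f x \<bullet> (?O (g x) *v f x)) \<in> borel_measurable M"
    using borel_measurable_continuous_Pair[where H = "\<lambda>A w. w \<bullet> (A *v w)" and f = "\<lambda>x. ?O (g x)" and g = f and M = M]
      cont by simp
  moreover have "(\<lambda>x. quad (f x) (g x)) = (\<lambda>x. f x \<bullet> (?O (g x) *v f x))"
    by (auto simp: quad_def fun_eq_iff)
  ultimately show ?thesis by simp
qed

lemma continuous_on_T_stat: "continuous_on (- Ns) (T_stat R r \<beta>c \<Omega>c N)"
proof -
  have "continuous_on (- Ns) (\<lambda>y. (R *v \<beta>c y - r) \<bullet> (matrix_inv (\<Omega>c y) *v (R *v \<beta>c y - r)))"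
    using continuous_on_estimators
    by (auto simp: continuous_on_def intro!: tendsto_intros tendsto_matrix_vector_mult)
  then show ?thesis
    by (rule continuous_on_eq) (simp add: T_stat_def)
qed

lemma measurable_T_stat [measurable]: "T_stat R r \<beta>c \<Omega>c N \<in> borel_measurable borel"
proof -
  have "T_stat R r \<beta>c \<Omega>c N = (\<lambda>y. if y \<in> Ns then 0 else T_stat R r \<beta>c \<Omega>c N y)"
    by (auto simp: T_stat_def)
  also have "\<dots> \<in> borel_measurable borel"
    by (intro borel_measurable_continuous_on_if sets_Ns continuous_on_const continuous_on_T_stat)
  finally show ?thesis .
qed

lemma tendsto_T_stat:
  assumes "v \<longlonglongrightarrow> y" and "y \<notin> Ns"
  shows "(\<lambda>m :: nat. T_stat R r \<beta>c \<Omega>c N (v m)) \<longlonglongrightarrow> T_stat R r \<beta>c \<Omega>c N y"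
proof -
  have "isCont (T_stat R r \<beta>c \<Omega>c N) y"
    using continuous_on_T_stat assms(2) closed_Ns
    by (metis ComplI continuous_on_eq_continuous_at open_Compl)
  then show ?thesis using assms(1) by (rule isCont_tendsto_compose)
qed

text \<open>With w = \<Omega> u the form of the inverse at w is u' \<Omega> u. A singular \<Omega>
  is covered by the default value 0.\<close>

lemma quad_nonneg:
  assumes "nonneg_definite (\<Omega>c y)"
  shows "0 \<le> quad w y"
proof (cases "y \<in> Ns")
  case False
  then have inv: "invertible (\<Omega>c y)" by (simp add: not_in_Ns_iff)
  define u where "u = matrix_inv (\<Omega>c y) *v w"
  have w: "w = \<Omega>c y *v u" using matrix_inv_mult_vector(1)[OF inv] by (simp add: u_def)
  have "0 \<le> u \<bullet> (\<Omega>c y *v u)" using assms by (simp add: nonneg_definite_def)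
  then show ?thesis using False by (simp add: quad_def u_def[symmetric] w[symmetric] inner_commute)
qed (simp add: quad_def)

lemma quad_continuous: "(w \<longlongrightarrow> w0) F \<Longrightarrow> ((\<lambda>t. quad (w t) y) \<longlongrightarrow> quad w0 y) F"
  unfolding quad_def by (intro tendsto_intros tendsto_matrix_vector_mult) auto

end

section \<open>Least squares, the null space, and Fatou's lemma for events\<close>

lemma measurable_beta_hat [measurable]: "beta_hat X \<in> borel_measurable borel"
  unfolding beta_hat_def[abs_def] by measurable

lemma linear_beta_hat: "linear (beta_hat X)"
  unfolding beta_hat_def[abs_def]
  by (intro linearI) (simp_all add: matrix_vector_right_distrib matrix_vector_mult_scaleR del: transpose_matrix_vector)

lemma beta_hat_mult:
  fixes X :: "real ^ 'k ^ 'n"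
  assumes "rank X = CARD('k)"
  shows "beta_hat X (X *v b) = b"
proof -
  have inj: "inj ((*v) X)" using assms by (simp add: full_rank_injective)
  have "v = 0" if "(transpose X ** X) *v v = 0" for v
  proof -
    have "(X *v v) \<bullet> (X *v v) = v \<bullet> ((transpose X ** X) *v v)"
      unfolding matrix_vector_mul_assoc[symmetric] inner_matrix_vector_transpose[of v "transpose X"] by simp
    then have "X *v v = X *v 0" using that by simp
    then show ?thesis using inj by (rule injD[rotated])
  qed
  then have "invertible (transpose X ** X)"
    by (metis matrix_left_invertible_ker invertible_left_inverse)
  then show ?thesis
    using matrix_inv_mult_vector(2)[of "transpose X ** X" b]
    by (simp add: beta_hat_def matrix_vector_mul_assoc matrix_mul_assoc del: transpose_matrix_vector)
qed

lemma subspace_M0_lin: "subspace (M0_lin X R)"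
proof (rule subspaceI)
  show "0 \<in> M0_lin X R" unfolding M0_def by (auto intro!: exI[of _ 0])
  fix x y c assume "x \<in> M0_lin X R"
  then obtain a where a: "x = X *v a" "R *v a = 0" by (auto simp: M0_def)
  show "c *\<^sub>R x \<in> M0_lin X R"
    unfolding M0_def using a by (auto intro!: exI[of _ "c *\<^sub>R a"] simp: matrix_vector_mult_scaleR)
  assume "y \<in> M0_lin X R"
  then obtain b where b: "y = X *v b" "R *v b = 0" by (auto simp: M0_def)
  show "x + y \<in> M0_lin X R"
    unfolding M0_def using a b by (auto intro!: exI[of _ "a + b"] simp: matrix_vector_right_distrib)
qed

lemma M0_lin_neq_UNIV:
  fixes X :: "real ^ 'k ^ 'n"
  assumes "CARD('k) < CARD('n)" and "rank X = CARD('k)"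
  shows "M0_lin X R \<noteq> UNIV"
proof
  assume "M0_lin X R = UNIV"
  then have "range ((*v) X) = UNIV" by (auto simp: M0_def set_eq_iff)
  then have "rank X = CARD('n)" by (simp add: rank_dim_range dim_UNIV)
  then show False using assms by simp
qed

text \<open>Fatou's lemma for indicators: almost surely B lies in the limit inferior of the A m. It
  carries an upper bound on probabilities through a limit that is known only pointwise.\<close>

lemma (in prob_space) prob_le_of_eventually_mem:
  assumes [measurable]: "\<And>m :: nat. A m \<in> events" "B \<in> events"
    and ev: "AE x in M. x \<in> B \<longrightarrow> eventually (\<lambda>m. x \<in> A m) sequentially"
    and le: "\<And>m. prob (A m) \<le> c"
  shows "prob B \<le> c"
proof -
  have c: "0 \<le> c" using le[of 0] measure_nonneg order_trans by blast
  have "emeasure M B = (\<integral>\<^sup>+x. indicator B x \<partial>M)" by simp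
  also have "\<dots> \<le> (\<integral>\<^sup>+x. liminf (\<lambda>m. indicator (A m) x) \<partial>M)"
  proof (rule nn_integral_mono_AE)
    show "AE x in M. indicator B x \<le> (liminf (\<lambda>m. indicator (A m) x) :: ennreal)"
      using ev
    proof eventually_elim
      case (elim x)
      show ?case
      proof (cases "x \<in> B")
        case True
        then have "eventually (\<lambda>m. (1 :: ennreal) \<le> indicator (A m) x) sequentially"
          using elim by (auto elim: eventually_mono)
        then have "1 \<le> (liminf (\<lambda>m. indicator (A m) x) :: ennreal)" by (rule Liminf_bounded)
        then show ?thesis using True by simp
      qed simp
    qed
  qed
  also have "\<dots> \<le> liminf (\<lambda>m. \<integral>\<^sup>+x. indicator (A m) x \<partial>M)"
    by (rule nn_integral_liminf) measurable
  also have "\<dots> \<le> ennreal c"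
    using le by (intro Liminf_le always_eventually) (auto simp: emeasure_eq_measure ennreal_leI)
  finally show ?thesis using c by (simp add: emeasure_eq_measure)
qed

subsection \<open>The two inequalities\<close>

lemma measure_gaussian_le_SUP:
  assumes "f \<in> F"
  shows "measure (gaussian \<mu> (c *\<^sub>R Sigma_mat f)) S \<le> (SUP f\<in>F. measure (gaussian \<mu> (c *\<^sub>R Sigma_mat f)) S)"
proof (rule cSUP_upper[OF assms])
  \<comment> \<open>A supremum of reals dominates its members only if the set is bounded; for
    probabilities 1 is a bound.\<close>
  show "bdd_above ((\<lambda>f. measure (gaussian \<mu> (c *\<^sub>R Sigma_mat f)) S) ` F)"
    using prob_space.prob_le_1[OF prob_space_gaussian] by (intro bdd_aboveI[of _ 1]) auto
qed

lemma pair_prob_space_std_gaussian: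
  "pair_prob_space (std_gaussian :: (real ^ 'm) measure) (std_gaussian :: (real ^ 'n) measure)"
  by (simp add: pair_prob_space_def pair_sigma_finite_def prob_space_std_gaussian prob_space_imp_sigma_finite)

lemma measure_std_gaussian_UNIV [simp]: "measure std_gaussian UNIV = 1"
  using prob_space.prob_space[OF prob_space_std_gaussian] by simp

section \<open>The integral K and its lower bound\<close>

locale f_test = equivariant_estimators X \<beta>c \<Omega>c N
  for X :: "real ^ 'k ^ ('n::{finite,linorder})"
    and \<beta>c :: "real ^ ('n::{finite,linorder}) \<Rightarrow> real ^ 'k"
    and \<Omega>c :: "real ^ ('n::{finite,linorder}) \<Rightarrow> real ^ 'q ^ 'q"
    and N :: "(real ^ ('n::{finite,linorder})) set" +
  fixes R :: "real ^ 'k ^ 'q" and \<gamma> :: real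
  assumes card: "CARD('k) < CARD('n)" and rank: "rank X = CARD('k)"
    and nondegenerate: "\<And>v :: real ^ 'q. v \<noteq> 0 \<Longrightarrow>
      {y. y \<notin> N_star \<Omega>c N \<and> v \<bullet> (matrix_inv (\<Omega>c y) *v v) = 0} \<in> null_sets lebesgue"
    and \<gamma>: "\<gamma> \<in> {0..pi}"
    and span: "span (columns (E_mat (rho \<gamma> (M0_lin X R)) \<gamma>)) \<subseteq> span (columns X)"
begin

abbreviation \<rho> :: nat where "\<rho> \<equiv> rho \<gamma> (M0_lin X R)"

text \<open>The vector inside \<xi>, with a two-dimensional argument even at \<gamma> = 0 and
  \<gamma> = \<pi>, so that one limit argument serves all frequencies. The one-dimensional version
  is recovered in \<open>K_bound_eq\<close>.\<close>

definition wt :: "real ^ 2 \<Rightarrow> real ^ 'q" where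
  "wt y = R *v beta_hat X (E_mat \<rho> \<gamma> *v y)"

lemma measurable_wt [measurable]: "wt \<in> borel_measurable borel"
  unfolding wt_def[abs_def] by measurable

text \<open>By the span hypothesis the regressor is fitted exactly, and least squares returns its
  coefficient vector b.\<close>

lemma regressor_factor:
  obtains b where "E_mat \<rho> \<gamma> *v y = X *v b" and "wt y = R *v b"
proof -
  have "E_mat \<rho> \<gamma> *v y \<in> span (columns X)"
    using span matrix_vector_mult_in_columnspace[of "E_mat \<rho> \<gamma> :: real ^ 2 ^ ('n::{finite,linorder})" y] by blast
  then have "E_mat \<rho> \<gamma> *v y \<in> range ((*v) X)"
  proof (rule subsetD[OF span_minimal, rotated -1])
    show "columns X \<subseteq> range ((*v) X)" by (auto simp: columns_image_basis)
    show "subspace (range ((*v) X))" by (intro linear_subspace_image matrix_vector_mul_linear subspace_UNIV)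
  qed
  then obtain b where "E_mat \<rho> \<gamma> *v y = X *v b" by blast
  then show thesis using that by (simp add: wt_def beta_hat_mult[OF rank])
qed

text \<open>If \<open>wt y = 0\<close>, then the regressor at y lies in \<open>M0_lin X R\<close>.
  Such y form a subspace of the plane, proper by the choice of \<rho>, hence a null set.\<close>

lemma AE_wt_nonzero: "AE y in std_gaussian. wt y \<noteq> 0"
proof -
  let ?L = "M0_lin X R"
  define S where "S = {y. E_mat \<rho> \<gamma> *v y \<in> ?L}"
  have L: "subspace ?L" "?L \<noteq> UNIV"
    by (rule subspace_M0_lin, rule M0_lin_neq_UNIV[OF card rank])
  have "subspace S"
    unfolding S_def by (rule linear_subspace_linear_preimage[OF matrix_vector_mul_linear L(1)])
  moreover have "S \<noteq> UNIV"
  proof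
    assume "S = UNIV"
    then have in_L: "E_mat \<rho> \<gamma> *v y \<in> ?L" for y by (auto simp: S_def)
    have "columns (E_mat \<rho> \<gamma> :: real ^ 2 ^ ('n::{finite,linorder})) \<subseteq> ?L"
      using in_L[of "axis _ 1"] by (auto simp: columns_def matrix_vector_mult_basis)
    then show False using rho_properties(1)[OF L, of \<gamma>] span_minimal[OF _ L(1)] by blast
  qed
  ultimately have "AE y in std_gaussian. y \<notin> S" by (rule AE_std_gaussian_not_in_subspace)
  then show ?thesis
  proof eventually_elim
    case (elim y)
    obtain b where b: "E_mat \<rho> \<gamma> *v y = X *v b" "wt y = R *v b" by (rule regressor_factor)
    then show ?case using elim by (auto simp: S_def M0_def)
  qed
qed

lemma AE_quad_nonzero:
  assumes "v \<noteq> 0"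
  shows "AE y in std_gaussian. quad v y \<noteq> 0"
proof -
  have "AE y in std_gaussian. y \<notin> {y. y \<notin> Ns \<and> v \<bullet> (matrix_inv (\<Omega>c y) *v v) = 0}"
    by (intro AE_std_gaussian_lebesgue AE_not_in nondegenerate assms)
  with AE_not_in_Ns show ?thesis by eventually_elim (simp add: quad_def)
qed

text \<open>Joins the weak inequality in K to the strict one that the limits deliver; here the
  hypothesis on the zeros of the quadratic form enters.\<close>

lemma measure_quad_nonneg_eq_pos:
  assumes "v \<noteq> 0"
  shows "measure std_gaussian {y. 0 \<le> quad v y} = measure std_gaussian {y. 0 < quad v y}"
proof (rule measure_eq_AE)
  show "AE y in std_gaussian. y \<in> {y. 0 \<le> quad v y} \<longleftrightarrow> y \<in> {y. 0 < quad v y}"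
    using AE_quad_nonzero[OF assms] by eventually_elim auto
qed measurable

lemma measurable_measure_quad [measurable]:
  "(\<lambda>v. measure std_gaussian {y. 0 \<le> quad v y}) \<in> borel_measurable borel"
  "(\<lambda>v. measure std_gaussian {y. 0 < quad v y}) \<in> borel_measurable borel"
proof -
  interpret std: sigma_finite_measure "std_gaussian :: (real ^ ('n::{finite,linorder})) measure"
    by (intro prob_space_imp_sigma_finite prob_space_std_gaussian)
  let ?P = "borel \<Otimes>\<^sub>M (std_gaussian :: (real ^ ('n::{finite,linorder})) measure)"
  have "{p \<in> space ?P. 0 \<le> quad (fst p) (snd p)} \<in> sets ?P" "{p \<in> space ?P. 0 < quad (fst p) (snd p)} \<in> sets ?P"
    by measurable
  from this[THEN std.measurable_emeasure_Pair] have [measurable]: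
    "(\<lambda>v. emeasure std_gaussian {y. 0 \<le> quad v y}) \<in> borel_measurable borel"
    "(\<lambda>v. emeasure std_gaussian {y. 0 < quad v y}) \<in> borel_measurable borel"
    by (simp_all add: vimage_def space_pair_measure)
  show "(\<lambda>v. measure std_gaussian {y. 0 \<le> quad v y}) \<in> borel_measurable borel"
    "(\<lambda>v. measure std_gaussian {y. 0 < quad v y}) \<in> borel_measurable borel"
    unfolding measure_def by measurable
qed

lemma integrable_measure_quad:
  assumes "f \<in> borel_measurable borel"
  shows "integrable (std_gaussian :: (real ^ 'm) measure) (\<lambda>x. measure std_gaussian {y. 0 \<le> quad (f x) y})"
proof -
  interpret std: prob_space "std_gaussian :: (real ^ 'm) measure" by (rule prob_space_std_gaussian)
  note [measurable] = assms
  show ?thesis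
    using prob_space.prob_le_1[OF prob_space_std_gaussian]
    by (intro std.integrable_const_bound[of _ 1]) auto
qed

lemma K_int_eq:
  fixes M :: "'w measure" and E :: "real ^ 'm ^ ('n::{finite,linorder})"
  assumes [measurable]: "G \<in> borel_measurable M" and G: "distr M borel G = gaussian 0 (mat 1)"
  shows "K_int M G X R \<Omega>c N E =
    (\<integral>x. measure std_gaussian {y. 0 \<le> quad (R *v beta_hat X (E *v x)) y} \<partial>std_gaussian)"
proof -
  have "measure M {w \<in> space M. 0 \<le> quad v (G w)} = measure std_gaussian {y. 0 \<le> quad v y}" for v
  proof -
    have "measure (distr M borel G) {y. 0 \<le> quad v y} = measure M {w \<in> space M. 0 \<le> quad v (G w)}"
      by (subst measure_distr) (auto intro!: arg_cong[where f = "measure M"])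
    then show ?thesis by (simp add: G gaussian_mat_1)
  qed
  then show ?thesis by (simp add: K_int_def xi_bar_eq_quad gaussian_mat_1)
qed

text \<open>Where \<Omega> is nonnegative definite, the quadratic form is nonnegative at every
  vector. So the integrand of K is at least this probability at each x. As \<open>E\<close> is
  arbitrary, both cases of \<open>K_bound\<close> are covered.\<close>

lemma nonneg_definite_le_K_int:
  fixes M :: "'w measure" and E :: "real ^ 'm ^ ('n::{finite,linorder})"
  assumes "G \<in> borel_measurable M" and "distr M borel G = gaussian 0 (mat 1)"
  shows "measure (gaussian 0 (mat 1)) {y. y \<notin> N \<and> nonneg_definite (\<Omega>c y)} \<le> K_int M G X R \<Omega>c N E"
proof -
  interpret std: prob_space "std_gaussian :: (real ^ ('n::{finite,linorder})) measure" by (rule prob_space_std_gaussian)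
  interpret stdm: prob_space "std_gaussian :: (real ^ 'm) measure" by (rule prob_space_std_gaussian)
  let ?p = "measure std_gaussian {y. y \<notin> N \<and> nonneg_definite (\<Omega>c y)}"
  have "?p \<le> measure std_gaussian {y. 0 \<le> quad v y}" for v
    by (rule std.finite_measure_mono) (auto intro: quad_nonneg)
  moreover have "(\<lambda>x. R *v beta_hat X (E *v x)) \<in> borel_measurable borel" by measurable
  ultimately have "(\<integral>x. ?p \<partial>(std_gaussian :: (real ^ 'm) measure)) \<le>
      (\<integral>x. measure std_gaussian {y. 0 \<le> quad (R *v beta_hat X (E *v x)) y} \<partial>std_gaussian)"
    by (intro integral_mono integrable_measure_quad) auto
  then show ?thesis
    unfolding K_int_eq[OF assms] gaussian_mat_1 using stdm.prob_space by simp
qed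

lemma quad_nonneg_scaleR:
  assumes "c \<noteq> 0"
  shows "0 \<le> quad (c *\<^sub>R v) y \<longleftrightarrow> 0 \<le> quad v y"
  using assms by (simp add: quad_scaleR zero_le_mult_iff)

lemma AE_coordinate_nonzero: "AE x in (std_gaussian :: (real ^ 'm) measure). x $ i \<noteq> 0"
proof -
  have "subspace {x :: real ^ 'm. x $ i = 0}" by (auto simp: subspace_def)
  moreover have "axis i 1 \<notin> {x :: real ^ 'm. x $ i = 0}" by simp
  then have "{x :: real ^ 'm. x $ i = 0} \<noteq> UNIV" by blast
  ultimately have "AE x in (std_gaussian :: (real ^ 'm) measure). x \<notin> {x. x $ i = 0}"
    by (intro AE_std_gaussian_not_in_subspace) auto
  then show ?thesis by simp
qed

text \<open>
  For \<open>\<gamma> \<in> {0, \<pi>}\<close> the second column of \<open>E\<close> vanishes, and the sign of the quadratic form does not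
  change when its argument is rescaled, so that both integrands are almost surely the same constant.
\<close>
lemma K_bound_eq:
  fixes M :: "'w measure"
  assumes G: "G \<in> borel_measurable M" "distr M borel G = gaussian 0 (mat 1)"
  shows "K_bound M G X R \<Omega>c N \<gamma> = (\<integral>y. measure std_gaussian {z. 0 < quad (wt y) z} \<partial>std_gaussian)"
proof -
  let ?E = "E_mat \<rho> \<gamma> :: real ^ 2 ^ ('n::{finite,linorder})"
  have "(\<integral>y. measure std_gaussian {z. 0 < quad (wt y) z} \<partial>std_gaussian) =
      (\<integral>y. measure std_gaussian {z. 0 \<le> quad (wt y) z} \<partial>std_gaussian)"
  proof (rule integral_cong_AE)
    show "AE y in std_gaussian. measure std_gaussian {z. 0 < quad (wt y) z} = measure std_gaussian {z. 0 \<le> quad (wt y) z}"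
      using AE_wt_nonzero by eventually_elim (simp add: measure_quad_nonneg_eq_pos)
  qed measurable
  also have "\<dots> = K_bound M G X R \<Omega>c N \<gamma>"
  proof (cases "0 < \<gamma> \<and> \<gamma> < pi")
    case True
    then show ?thesis by (simp add: K_bound_def K_int_eq[OF G] wt_def)
  next
    case False
    then have "\<gamma> = 0 \<or> \<gamma> = pi" using \<gamma> by auto
    then have sin0: "sin (real (pos j) * \<gamma>) = 0" for j :: "'n::{finite,linorder}" by auto
    define e where "e = (\<chi> j. ?E $ j $ 1)"
    define w0 where "w0 = R *v beta_hat X e"
    have e_nth: "e $ j = real (pos j) ^ \<rho> * cos (real (pos j) * \<gamma>)" for j
      by (simp add: e_def E_mat_def)
    have E2: "?E *v y = (y $ 1) *\<^sub>R e" for y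
      by (simp add: vec_eq_iff E_mat_mult_vector_nth sin0 e_nth)
    have E1: "first_column ?E *v x = (x $ 1) *\<^sub>R e" for x
      by (simp add: vec_eq_iff first_column_def e_def matrix_vector_mult_def sum_1)
    let ?c = "measure std_gaussian {z. 0 \<le> quad w0 z}"
    have "(\<integral>y. measure std_gaussian {z. 0 \<le> quad (wt y) z} \<partial>std_gaussian) = (\<integral>y. ?c \<partial>(std_gaussian :: (real ^ 2) measure))"
    proof (rule integral_cong_AE)
      show "AE y in std_gaussian. measure std_gaussian {z. 0 \<le> quad (wt y) z} = ?c"
        using AE_coordinate_nonzero[of 1]
        by eventually_elim
          (simp add: wt_def E2 linear_cmul[OF linear_beta_hat] matrix_vector_mult_scaleR quad_nonneg_scaleR w0_def)
    qed measurable
    moreover have "(\<integral>x. measure std_gaussian {y. 0 \<le> quad (R *v beta_hat X (first_column ?E *v x)) y} \<partial>std_gaussian) =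
        (\<integral>x. ?c \<partial>(std_gaussian :: (real ^ 1) measure))"
    proof (rule integral_cong_AE)
      show "AE x in std_gaussian. measure std_gaussian {y. 0 \<le> quad (R *v beta_hat X (first_column ?E *v x)) y} = ?c"
        using AE_coordinate_nonzero[of 1]
        by eventually_elim
          (simp add: E1 linear_cmul[OF linear_beta_hat] matrix_vector_mult_scaleR quad_nonneg_scaleR w0_def)
    qed measurable
    ultimately show ?thesis
      unfolding K_bound_def Let_def if_not_P[OF False] K_int_eq[OF G] by simp
  qed
  finally show ?thesis by simp
qed

end

section \<open>The three limits\<close>

context f_test
begin

abbreviation T0 :: "real ^ ('n::{finite,linorder}) \<Rightarrow> real" where
  "T0 \<equiv> T_stat R 0 \<beta>c \<Omega>c N"

abbreviation P2 :: "((real ^ 2) \<times> (real ^ ('n::{finite,linorder}))) measure" where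
  "P2 \<equiv> std_gaussian \<Otimes>\<^sub>M std_gaussian"

lemma prob_space_P2: "prob_space P2"
proof -
  interpret pair_prob_space "std_gaussian :: (real ^ 2) measure" "std_gaussian :: (real ^ ('n::{finite,linorder})) measure"
    by (rule pair_prob_space_std_gaussian)
  show ?thesis by unfold_locales
qed

lemma space_P2: "space P2 = UNIV"
  by (simp add: space_pair_measure)

lemma AE_P2_not_in_Ns: "AE p in P2. snd p \<notin> Ns"
proof -
  interpret pair_prob_space "std_gaussian :: (real ^ 2) measure" "std_gaussian :: (real ^ ('n::{finite,linorder})) measure"
    by (rule pair_prob_space_std_gaussian)
  show ?thesis
  proof (rule AE_pair_measure)
    show "{p \<in> space P2. snd p \<notin> Ns} \<in> sets P2" by measurable
    show "AE x in std_gaussian. AE y in std_gaussian. snd (x, y) \<notin> Ns" using AE_not_in_Ns by simp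
  qed
qed

text \<open>The limiting covariance is a multiple of E E' + s^2 I, the covariance of E x + s z, and
  scale invariance discards the multiple. This also removes \<sigma>^2, as the shift lemma removes
  \<mu>.\<close>

lemma singular_limit_le_SUP:
  assumes F: "F_AR2_ext \<subseteq> F" and \<mu>: "\<mu> \<in> M0 X R r" and \<sigma>: "0 < \<sigma>2"
    and \<theta>: "0 < \<theta>" "\<theta> < pi" and s: "s \<noteq> 0"
  shows "measure P2 {p. C \<le> T0 (E_mat 0 \<theta> *v fst p + s *\<^sub>R snd p)} \<le>
    (SUP f\<in>F. measure (gaussian \<mu> (\<sigma>2 *\<^sub>R Sigma_mat f)) {y. C \<le> T_stat R r \<beta>c \<Omega>c N y})"
    (is "_ \<le> ?sup")
proof -
  let ?E = "E_mat 0 \<theta> :: real ^ 2 ^ ('n::{finite,linorder})"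
  \<comment> \<open>The weights solve c1 + c2 = 1 and c2 = s^2 c1.\<close>
  define c1 where "c1 = 1 / (1 + s\<^sup>2)"
  define c2 where "c2 = s\<^sup>2 / (1 + s\<^sup>2)"
  have s2: "0 < s\<^sup>2" using s by simp
  then have s1: "1 + s\<^sup>2 \<noteq> 0" by linarith
  have c: "0 < c1" "0 < c2" "c1 + c2 = 1"
    using s2 s1 unfolding c1_def c2_def by (auto simp: add_divide_distrib[symmetric] add_pos_pos)
  obtain f where fF: "\<And>m :: nat. f m \<in> F_AR2_ext"
    and pd: "\<And>m. pos_definite (Sigma_mat (f m) :: real ^ ('n::{finite,linorder}) ^ ('n::{finite,linorder}))"
    and lim: "(\<lambda>m. Sigma_mat (f m) :: real ^ ('n::{finite,linorder}) ^ ('n::{finite,linorder})) \<longlonglongrightarrow>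
      c1 *\<^sub>R (?E ** transpose ?E) + c2 *\<^sub>R mat 1"
    using F_AR2_ext_approximation[OF \<theta> c] by blast
  \<comment> \<open>Then \<sigma>^2 (c1 E E' + c2 I) = a^2 (E E' + s^2 I), and a is the scale to be
    discarded.\<close>
  define a where "a = sqrt (\<sigma>2 * c1)"
  have a: "a \<noteq> 0" "a\<^sup>2 = \<sigma>2 * c1" using \<sigma> c by (simp_all add: a_def)
  have as: "(a * s)\<^sup>2 = \<sigma>2 * c2"
    by (simp add: power_mult_distrib a c1_def c2_def)
  let ?A = "(a *\<^sub>R ?E) ** transpose (a *\<^sub>R ?E) + ((a * s)\<^sup>2) *\<^sub>R mat 1"
  have A: "?A = \<sigma>2 *\<^sub>R (c1 *\<^sub>R (?E ** transpose ?E) + c2 *\<^sub>R mat 1)"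
  proof -
    have "?A = (a\<^sup>2) *\<^sub>R (?E ** transpose ?E) + (\<sigma>2 * c2) *\<^sub>R mat 1"
      by (simp only: as transpose_scalar matrix_mult_scaleR scaleR_scaleR power2_eq_square[of a, symmetric])
    then show ?thesis by (simp add: a(2) scaleR_add_right)
  qed
  have "a * s \<noteq> 0" using a s by simp
  note pdA = pos_definite_outer_plus[OF this, of "a *\<^sub>R ?E"] and conv = gaussian_convolution[OF this, of "a *\<^sub>R ?E"]
  let ?S = "{u. C \<le> T0 u}"
  have S [measurable]: "?S \<in> sets borel" by measurable
  obtain \<beta> where \<beta>: "\<mu> = X *v \<beta>" "R *v \<beta> = r" using \<mu> by (auto simp: M0_def)
  have shift: "measure (gaussian \<mu> B) {y. C \<le> T_stat R r \<beta>c \<Omega>c N y} = measure (gaussian 0 B) ?S" for B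
  proof -
    have "{y. C \<le> T_stat R r \<beta>c \<Omega>c N y} \<in> sets borel" by measurable
    moreover have "(\<lambda>u. \<mu> + u) -` {y. C \<le> T_stat R r \<beta>c \<Omega>c N y} = ?S"
      by (auto simp: \<beta>(1) T_stat_null_shift[OF \<beta>(2)])
    ultimately show ?thesis using gaussian_shift[of "{y. C \<le> T_stat R r \<beta>c \<Omega>c N y}" \<mu> B] by (simp add: measure_def)
  qed
  have "(\<lambda>m. measure (gaussian 0 (\<sigma>2 *\<^sub>R Sigma_mat (f m))) ?S) \<longlonglongrightarrow> measure (gaussian 0 ?A) ?S"
  proof (rule measure_gaussian_tendsto[OF _ _ pdA S])
    show "(\<lambda>m. \<sigma>2 *\<^sub>R Sigma_mat (f m)) \<longlonglongrightarrow> ?A"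
      unfolding A by (intro tendsto_intros lim)
  qed (intro pos_definite_scaleR pd \<sigma>)
  moreover have "measure (gaussian 0 (\<sigma>2 *\<^sub>R Sigma_mat (f m))) ?S \<le> ?sup" for m
    unfolding shift[symmetric] using fF[of m] F by (intro measure_gaussian_le_SUP) auto
  ultimately have "measure (gaussian 0 ?A) ?S \<le> ?sup" by (intro LIMSEQ_le_const2) auto
  also have "measure (gaussian 0 ?A) ?S = measure P2 {p. C \<le> T0 ((a *\<^sub>R ?E) *v fst p + (a * s) *\<^sub>R snd p)}"
    unfolding conv[symmetric] by (subst measure_distr) (auto simp: space_P2 vimage_def case_prod_beta')
  finally have le: "measure P2 {p. C \<le> T0 ((a *\<^sub>R ?E) *v fst p + (a * s) *\<^sub>R snd p)} \<le> ?sup" .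
  have "T0 ((a *\<^sub>R ?E) *v fst p + (a * s) *\<^sub>R snd p) = T0 (?E *v fst p + s *\<^sub>R snd p)" for p
  proof -
    have "(a *\<^sub>R ?E) *v fst p + (a * s) *\<^sub>R snd p = a *\<^sub>R (?E *v fst p + s *\<^sub>R snd p) + 0"
      by (simp add: matrix_scaleR_vector scaleR_add_right)
    then show ?thesis
      by (simp only: T_stat_invariant[OF subspace_0[OF subspace_M0_lin] a(1)])
  qed
  then show ?thesis using le by simp
qed

lemma frequencies_near_gamma:
  obtains \<eta> :: "nat \<Rightarrow> real" where "\<eta> \<longlonglongrightarrow> 0" and "\<And>m. \<eta> m \<noteq> 0" and "\<And>m. 0 < \<gamma> + \<eta> m" and "\<And>m. \<gamma> + \<eta> m < pi"
proof -
  \<comment> \<open>From \<gamma> < \<pi> the frequencies come down from the side of \<pi>, from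
    \<gamma> = \<pi> they come up from the side of 0. The factor 1 / (m + 2) is below 1 and keeps
    them strictly inside.\<close>
  define d where "d = (if \<gamma> < pi then pi - \<gamma> else - pi)"
  have "(\<lambda>m. d * inverse (real (Suc (Suc m)))) \<longlonglongrightarrow> d * 0"
    by (intro tendsto_intros LIMSEQ_Suc[OF LIMSEQ_inverse_real_of_nat])
  moreover have "d * inverse (real (Suc (Suc m))) \<noteq> 0" for m using \<gamma> by (auto simp: d_def)
  moreover have "0 < \<gamma> + d * inverse (real (Suc (Suc m)))" "\<gamma> + d * inverse (real (Suc (Suc m))) < pi" for m
  proof -
    define t where "t = inverse (real (Suc (Suc m)))"
    have t: "0 < t" "t < 1" by (simp_all add: t_def inverse_less_1_iff)
    have "0 < \<gamma> + d * t \<and> \<gamma> + d * t < pi"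
    proof (cases "\<gamma> < pi")
      case True
      then have d: "d = pi - \<gamma>" by (simp add: d_def)
      have "0 < (pi - \<gamma>) * t" using True t by simp
      moreover have "(pi - \<gamma>) * t < (pi - \<gamma>) * 1" using True t by (intro mult_strict_left_mono) auto
      ultimately show ?thesis using \<gamma> by (auto simp: d)
    next
      case False
      then have d: "d = - pi" "\<gamma> = pi" using \<gamma> by (auto simp: d_def)
      have "0 < pi * t" using t by simp
      moreover have "pi * t < pi * 1" using t by (intro mult_strict_left_mono) auto
      ultimately show ?thesis by (auto simp: d)
    qed
    then show "0 < \<gamma> + d * inverse (real (Suc (Suc m)))" "\<gamma> + d * inverse (real (Suc (Suc m))) < pi"
      by (auto simp: t_def)
  qed
  ultimately show thesis using that[of "\<lambda>m. d * inverse (real (Suc (Suc m)))"] by simp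
qed

abbreviation rot :: "real ^ 2 ^ 2" where
  "rot \<equiv> rotation (real \<rho> * pi / 2)"

text \<open>
  Modulo \<open>M0_lin\<close> only the Taylor coefficients of order at least \<open>\<rho>\<close> of \<open>E\<^sub>0(\<theta>) x\<close> at \<open>\<gamma>\<close>
  survive, and the noise is scaled to match the leading one.
\<close>
lemma frequency_limit_le_SUP:
  assumes F: "F_AR2_ext \<subseteq> F" and \<mu>: "\<mu> \<in> M0 X R r" and \<sigma>: "0 < \<sigma>2" and e: "e \<noteq> 0"
  shows "measure P2 {p. C < T0 (E_mat \<rho> \<gamma> *v (rot *v fst p) + e *\<^sub>R snd p)} \<le>
    (SUP f\<in>F. measure (gaussian \<mu> (\<sigma>2 *\<^sub>R Sigma_mat f)) {y. C \<le> T_stat R r \<beta>c \<Omega>c N y})"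
proof -
  interpret P2: prob_space P2 by (rule prob_space_P2)
  let ?L = "M0_lin X R"
  have L: "subspace ?L" "?L \<noteq> UNIV"
    by (rule subspace_M0_lin, rule M0_lin_neq_UNIV[OF card rank])
  obtain \<eta> where \<eta>: "\<eta> \<longlonglongrightarrow> 0" "\<And>m. \<eta> m \<noteq> 0" "\<And>m. 0 < \<gamma> + \<eta> m" "\<And>m. \<gamma> + \<eta> m < pi"
  proof (rule frequencies_near_gamma)
    fix \<eta> :: "nat \<Rightarrow> real"
    assume "\<eta> \<longlonglongrightarrow> 0" "\<And>m. \<eta> m \<noteq> 0" "\<And>m. 0 < \<gamma> + \<eta> m" "\<And>m. \<gamma> + \<eta> m < pi"
    then show thesis by (rule that)
  qed
  define a where "a m = \<eta> m ^ \<rho> / fact \<rho>" for m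
  have a0: "a m \<noteq> 0" for m using \<eta>(2) by (simp add: a_def)
  define A where "A m = {p. C \<le> T0 (E_mat 0 (\<gamma> + \<eta> m) *v fst p + (e * a m) *\<^sub>R snd p)}" for m
  show ?thesis
  proof (rule P2.prob_le_of_eventually_mem[where A = A])
    show "A m \<in> P2.events" for m
    proof -
      have "{p \<in> space P2. C \<le> T0 (E_mat 0 (\<gamma> + \<eta> m) *v fst p + (e * a m) *\<^sub>R snd p)} \<in> P2.events"
        by measurable
      then show ?thesis by (simp add: A_def space_P2)
    qed
    have "{p \<in> space P2. C < T0 (E_mat \<rho> \<gamma> *v (rot *v fst p) + e *\<^sub>R snd p)} \<in> P2.events"
      by measurable
    then show "{p. C < T0 (E_mat \<rho> \<gamma> *v (rot *v fst p) + e *\<^sub>R snd p)} \<in> P2.events"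
      by (simp add: space_P2)
    show "P2.prob (A m) \<le> (SUP f\<in>F. measure (gaussian \<mu> (\<sigma>2 *\<^sub>R Sigma_mat f)) {y. C \<le> T_stat R r \<beta>c \<Omega>c N y})" for m
      unfolding A_def using e a0 by (intro singular_limit_le_SUP assms \<eta>) simp
    show "AE p in P2. p \<in> {p. C < T0 (E_mat \<rho> \<gamma> *v (rot *v fst p) + e *\<^sub>R snd p)} \<longrightarrow>
        eventually (\<lambda>m. p \<in> A m) sequentially"
      using AE_P2_not_in_Ns
    proof eventually_elim
      case (elim p)
      define x where "x = fst p"
      define z where "z = snd p"
      define y where "y = rot *v x"
      have z: "z \<notin> Ns" using elim by (simp add: z_def)
      define Q where "Q m j t \<longleftrightarrow> \<bar>t\<bar> \<le> \<bar>\<eta> m\<bar> \<and> (E_mat 0 (\<gamma> + \<eta> m) *v x) $ j =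
          (\<Sum>s<\<rho>. (\<eta> m ^ s / fact s) * (E_mat s \<gamma> *v (rotation (real s * pi / 2) *v x)) $ j) +
          a m * (E_mat \<rho> (\<gamma> + t) *v y) $ j" for m t and j :: "'n::{finite,linorder}"
      have "\<exists>t. Q m j t" for m j
        unfolding Q_def a_def y_def by (rule E_mat_Taylor)
      then obtain t where t: "\<And>m j. Q m j (t m j)" by metis
      have t_le: "\<bar>t m j\<bar> \<le> \<bar>\<eta> m\<bar>" and Taylor: "(E_mat 0 (\<gamma> + \<eta> m) *v x) $ j =
          (\<Sum>s<\<rho>. (\<eta> m ^ s / fact s) * (E_mat s \<gamma> *v (rotation (real s * pi / 2) *v x)) $ j) +
          a m * (E_mat \<rho> (\<gamma> + t m j) *v y) $ j" for m j
        using t[of m j] by (auto simp: Q_def)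
      define l :: "nat \<Rightarrow> real ^ ('n::{finite,linorder})" where "l m = (\<Sum>s<\<rho>. (\<eta> m ^ s / fact s) *\<^sub>R (E_mat s \<gamma> *v (rotation (real s * pi / 2) *v x)))" for m
      have l: "l m \<in> ?L" for m
        unfolding l_def by (intro subspace_sum[OF L(1)] subspace_scale[OF L(1)] rho_properties(2)[OF L]) simp
      \<comment> \<open>The intermediate point of the Taylor remainder differs from row to row, so
        the remainder vector is assembled coordinatewise and is not a single \<open>E_mat\<close>
        applied to y.\<close>
      define v :: "nat \<Rightarrow> real ^ ('n::{finite,linorder})" where "v m = (\<chi> j. (E_mat \<rho> (\<gamma> + t m j) *v y) $ j)" for m
      have split: "E_mat 0 (\<gamma> + \<eta> m) *v x + (e * a m) *\<^sub>R z = a m *\<^sub>R (v m + e *\<^sub>R z) + l m" for m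
        by (simp add: vec_eq_iff Taylor l_def v_def algebra_simps)
      have T: "T0 (E_mat 0 (\<gamma> + \<eta> m) *v x + (e * a m) *\<^sub>R z) = T0 (v m + e *\<^sub>R z)" for m
        unfolding split by (rule T_stat_invariant[OF l a0])
      have "v \<longlonglongrightarrow> E_mat \<rho> \<gamma> *v y"
      proof (rule vec_tendstoI)
        fix j :: "'n::{finite,linorder}"
        have "(\<lambda>m. t m j) \<longlonglongrightarrow> 0"
          by (rule Lim_null_comparison[OF _ tendsto_norm_zero[OF \<eta>(1)]]) (simp add: t_le)
        then have "(\<lambda>m. \<gamma> + t m j) \<longlonglongrightarrow> \<gamma> + 0" by (intro tendsto_intros)
        then show "(\<lambda>m. v m $ j) \<longlonglongrightarrow> (E_mat \<rho> \<gamma> *v y) $ j"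
          unfolding v_def by (auto simp: E_mat_mult_vector_nth intro!: tendsto_intros)
      qed
      then have lim: "(\<lambda>m. v m + e *\<^sub>R z) \<longlonglongrightarrow> E_mat \<rho> \<gamma> *v y + e *\<^sub>R z"
        by (intro tendsto_intros)
      obtain b where "E_mat \<rho> \<gamma> *v y = X *v b" by (rule regressor_factor)
      \<comment> \<open>The regressor equals X b, so equivariance reduces the claim to z, which
        almost surely avoids the exceptional set. This gives continuity of the statistic at the
        limit point.\<close>
      then have "E_mat \<rho> \<gamma> *v y + e *\<^sub>R z \<notin> Ns"
        using in_Ns_iff[OF e, of z b] z by (simp add: add.commute)
      then have "(\<lambda>m. T0 (v m + e *\<^sub>R z)) \<longlonglongrightarrow> T0 (E_mat \<rho> \<gamma> *v y + e *\<^sub>R z)"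
        by (rule tendsto_T_stat[OF lim])
      \<comment> \<open>The strict inequality at the limit point is an open condition, so it holds
        along the sequence; there the weak inequality in \<open>A\<close> is enough.\<close>
      then have "C < T0 (E_mat \<rho> \<gamma> *v y + e *\<^sub>R z) \<longrightarrow> eventually (\<lambda>m. C < T0 (v m + e *\<^sub>R z)) sequentially"
        by (auto dest: order_tendstoD(1))
      then show ?case
        by (auto simp: A_def T[unfolded x_def z_def] y_def x_def z_def elim: eventually_mono)
    qed
  qed
qed

text \<open>Multiplied by e^2, the event C < T compares a quantity tending to the form of
  \<open>wt\<close> with C e^2, which tends to 0. Hence the result is the same for every critical
  value.\<close>

lemma noise_limit_le_SUP:
  assumes F: "F_AR2_ext \<subseteq> F" and \<mu>: "\<mu> \<in> M0 X R r" and \<sigma>: "0 < \<sigma>2"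
  shows "measure P2 {p. 0 < quad (wt (rot *v fst p)) (snd p)} \<le>
    (SUP f\<in>F. measure (gaussian \<mu> (\<sigma>2 *\<^sub>R Sigma_mat f)) {y. C \<le> T_stat R r \<beta>c \<Omega>c N y})"
proof -
  interpret P2: prob_space P2 by (rule prob_space_P2)
  define e where "e m = inverse (real (Suc m))" for m
  have e0: "e m \<noteq> 0" for m by (simp add: e_def)
  have elim0: "e \<longlonglongrightarrow> 0" unfolding e_def by (rule LIMSEQ_inverse_real_of_nat)
  define A where "A m = {p. C < T0 (E_mat \<rho> \<gamma> *v (rot *v fst p) + e m *\<^sub>R snd p)}" for m
  show ?thesis
  proof (rule P2.prob_le_of_eventually_mem[where A = A])
    show "A m \<in> P2.events" for m
    proof -
      have "{p \<in> space P2. C < T0 (E_mat \<rho> \<gamma> *v (rot *v fst p) + e m *\<^sub>R snd p)} \<in> P2.events"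
        by measurable
      then show ?thesis by (simp add: A_def space_P2)
    qed
    have "{p \<in> space P2. 0 < quad (wt (rot *v fst p)) (snd p)} \<in> P2.events"
      by measurable
    then show "{p. 0 < quad (wt (rot *v fst p)) (snd p)} \<in> P2.events"
      by (simp add: space_P2)
    show "P2.prob (A m) \<le> (SUP f\<in>F. measure (gaussian \<mu> (\<sigma>2 *\<^sub>R Sigma_mat f)) {y. C \<le> T_stat R r \<beta>c \<Omega>c N y})" for m
      unfolding A_def by (intro frequency_limit_le_SUP assms e0)
    show "AE p in P2. p \<in> {p. 0 < quad (wt (rot *v fst p)) (snd p)} \<longrightarrow> eventually (\<lambda>m. p \<in> A m) sequentially"
      using AE_P2_not_in_Ns
    proof eventually_elim
      case (elim p)
      define z where "z = snd p"
      define y where "y = rot *v fst p"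
      have z: "z \<notin> Ns" using elim by (simp add: z_def)
      obtain b where b: "E_mat \<rho> \<gamma> *v y = X *v b" "wt y = R *v b" by (rule regressor_factor)
      have T: "T0 (E_mat \<rho> \<gamma> *v y + e m *\<^sub>R z) = quad (R *v (e m *\<^sub>R \<beta>c z + b)) z / (e m)\<^sup>2" for m
        using T_stat_affine[OF z e0[of m], of R 0 b] by (simp add: b add.commute)
      have "eventually (\<lambda>m. C < T0 (E_mat \<rho> \<gamma> *v y + e m *\<^sub>R z)) sequentially" if pos: "0 < quad (wt y) z"
      proof -
        have "(\<lambda>m. R *v (e m *\<^sub>R \<beta>c z + b)) \<longlonglongrightarrow> R *v (0 *\<^sub>R \<beta>c z + b)"
          by (intro tendsto_matrix_vector_mult tendsto_intros elim0)
        then have "(\<lambda>m. quad (R *v (e m *\<^sub>R \<beta>c z + b)) z) \<longlonglongrightarrow> quad (wt y) z"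
          using quad_continuous[of "\<lambda>m. R *v (e m *\<^sub>R \<beta>c z + b)" "wt y" sequentially z] by (simp add: b)
        moreover have "(\<lambda>m. (e m)\<^sup>2) \<longlonglongrightarrow> 0" using tendsto_power[OF elim0, of 2] by simp
        then have "(\<lambda>m. C * (e m)\<^sup>2) \<longlonglongrightarrow> 0" using tendsto_mult_right_zero by blast
        ultimately have "(\<lambda>m. quad (R *v (e m *\<^sub>R \<beta>c z + b)) z - C * (e m)\<^sup>2) \<longlonglongrightarrow> quad (wt y) z - 0"
          by (intro tendsto_diff)
        then have "eventually (\<lambda>m. 0 < quad (R *v (e m *\<^sub>R \<beta>c z + b)) z - C * (e m)\<^sup>2) sequentially"
          using pos by (intro order_tendstoD(1)) auto
        then show ?thesis
        proof eventually_elim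
          case (elim m)
          moreover have "0 < (e m)\<^sup>2" using e0 by simp
          ultimately show ?case by (simp only: T) (simp add: pos_less_divide_eq)
        qed
      qed
      then show ?case by (simp add: A_def y_def z_def)
    qed
  qed
qed

text \<open>Fubini turns the probability from the last limit into an average over x, and rotation
  invariance of the standard normal law removes \<open>rot\<close>.\<close>

lemma K_bound_le_SUP:
  assumes F: "F_AR2_ext \<subseteq> F" and \<mu>: "\<mu> \<in> M0 X R r" and \<sigma>: "0 < \<sigma>2"
    and G: "G \<in> borel_measurable M" "distr M borel G = gaussian 0 (mat 1)"
  shows "K_bound M G X R \<Omega>c N \<gamma> \<le>
    (SUP f\<in>F. measure (gaussian \<mu> (\<sigma>2 *\<^sub>R Sigma_mat f)) {y. C \<le> T_stat R r \<beta>c \<Omega>c N y})"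
proof -
  interpret pair_prob_space "std_gaussian :: (real ^ 2) measure" "std_gaussian :: (real ^ ('n::{finite,linorder})) measure"
    by (rule pair_prob_space_std_gaussian)
  have rot: "distr std_gaussian borel (\<lambda>z. rot *v z) = std_gaussian"
    by (rule distr_std_gaussian_orthogonal[OF orthogonal_matrix_rotation])
  have ev: "{p. 0 < quad (wt (rot *v fst p)) (snd p)} \<in> sets P2"
  proof -
    have "{p \<in> space P2. 0 < quad (wt (rot *v fst p)) (snd p)} \<in> sets P2" by measurable
    then show ?thesis by (simp add: space_P2)
  qed
  have "emeasure P2 {p. 0 < quad (wt (rot *v fst p)) (snd p)} =
      (\<integral>\<^sup>+x. ennreal (measure std_gaussian {z. 0 < quad (wt (rot *v x)) z}) \<partial>std_gaussian)"
    unfolding M2.emeasure_pair_measure_alt[OF ev] by (simp add: vimage_def M2.emeasure_eq_measure)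
  also have "\<dots> = ennreal (\<integral>x. measure std_gaussian {z. 0 < quad (wt (rot *v x)) z} \<partial>std_gaussian)"
  proof (rule nn_integral_eq_integral)
    show "integrable std_gaussian (\<lambda>x. measure std_gaussian {z. 0 < quad (wt (rot *v x)) z})"
      using M2.prob_le_1 by (intro M1.integrable_const_bound[of _ 1]) auto
  qed auto
  finally have "measure P2 {p. 0 < quad (wt (rot *v fst p)) (snd p)} =
      (\<integral>x. measure std_gaussian {z. 0 < quad (wt (rot *v x)) z} \<partial>std_gaussian)"
    by (simp add: measure_def integral_nonneg_AE)
  also have "\<dots> = (\<integral>y. measure std_gaussian {z. 0 < quad (wt y) z} \<partial>distr std_gaussian borel (\<lambda>z. rot *v z))"
    by (subst integral_distr) measurable
  also have "\<dots> = K_bound M G X R \<Omega>c N \<gamma>"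
    unfolding rot K_bound_eq[OF G] ..
  finally show ?thesis using noise_limit_le_SUP[OF F \<mu> \<sigma>] by simp
qed

end

theorem theorem3p12:
  fixes X :: "real ^ 'k ^ ('n::{finite,linorder})"
    and R :: "real ^ 'k ^ 'q"
    and r :: "real ^ 'q"
    and F :: "(real \<Rightarrow> real) set"
    and \<beta>c :: "real ^ ('n::{finite,linorder}) \<Rightarrow> real ^ 'k"
    and \<Omega>c :: "real ^ ('n::{finite,linorder}) \<Rightarrow> real ^ 'q ^ 'q"
    and N :: "(real ^ ('n::{finite,linorder})) set"
    and \<gamma> :: real
    and M :: "'w measure"
    and G :: "'w \<Rightarrow> real ^ ('n::{finite,linorder})"
  assumes "CARD('k) < CARD('n)"
    and "rank X = CARD('k)"
    and "rank R = CARD('q)"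
    and "F \<subseteq> F_all"
    and "F_AR2_ext \<subseteq> F"
    and "estimator_conditions X \<beta>c \<Omega>c N"
    and "\<And>v :: real ^ 'q. v \<noteq> 0 \<Longrightarrow>
           {y. y \<notin> N_star \<Omega>c N \<and> v \<bullet> (matrix_inv (\<Omega>c y) *v v) = 0} \<in> null_sets lebesgue"
    and "\<gamma> \<in> {0..pi}"
    and "span (columns (E_mat (rho \<gamma> (M0_lin X R)) \<gamma>)) \<subseteq> span (columns X)"
    and "prob_space M"
    and "G \<in> borel_measurable M"
    and "distr M borel G = gaussian 0 (mat 1)"
  shows "\<forall>C :: real. \<forall>\<mu>0 \<in> M0 X R r. \<forall>\<sigma>2 > 0.
           measure (gaussian 0 (mat 1)) {y. y \<notin> N \<and> nonneg_definite (\<Omega>c y)}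
             \<le> K_bound M G X R \<Omega>c N \<gamma> \<and>
           K_bound M G X R \<Omega>c N \<gamma>
             \<le> (SUP f\<in>F. measure (gaussian \<mu>0 (\<sigma>2 *\<^sub>R Sigma_mat f))
                          {y. C \<le> T_stat R r \<beta>c \<Omega>c N y})"
proof -
  interpret f_test X \<beta>c \<Omega>c N R \<gamma>
    by unfold_locales (fact assms)+
  have "measure (gaussian 0 (mat 1)) {y. y \<notin> N \<and> nonneg_definite (\<Omega>c y)} \<le> K_bound M G X R \<Omega>c N \<gamma>"
    by (simp add: K_bound_def Let_def nonneg_definite_le_K_int[OF assms(11,12)])
  then show ?thesis
    using K_bound_le_SUP[OF assms(5) _ _ assms(11,12)] by blast
qed

end
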